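(* Let $X\in\mathbb{R}^{n\times p}$ and $\beta\in\mathbb{R}^p$ with $\mathrm{patt}(\beta)=M\ne0$. The following statements are equivalent: (i) There exist $\Lambda\in\mathbb{R}^{p+}$ and $\hat\beta\in S_{X,\Lambda}(X\beta)$ such that $\mathrm{patt}(\hat\beta)=\mathrm{patt}(\beta)$. (ii) For all $\lambda_1^0>0$, there exist $\Lambda=(\lambda_1,\dots,\lambda_p)'\in\mathbb{R}^{p+}$ with $\lambda_1<\lambda_1^0$ and $\hat\beta\in S_{X,\Lambda}(X\beta)$ such that $\mathrm{patt}(\hat\beta)=\mathrm{patt}(\beta)$. (iii) There exists $\Lambda\in\mathbb{R}^{p+}$ such that $X'(\tilde X_M')^+\tilde\Lambda_M\in\partial J_\Lambda(M)$ (or equivalently, $J^*_\Lambda(X'(\tilde X_M')^+\tilde\Lambda_M)\le1$ and $\tilde\Lambda_M\in\mathrm{col}(\tilde X_M')$). (iv) For all $\lambda_1^0>0$, there exists $\Lambda=(\lambda_1,\dots,\lambda_p)'\in\mathbb{R}^{p+}$ with $\lambda_1<\lambda_1^0$ such that $X'(\tilde X_M')^+\tilde\Lambda_M\in\partial J_\Lambda(M)$.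
   Context: Notation: $A'$ is the transpose, $A^+$ the Moore-Penrose pseudo-inverse, $\mathrm{col}(A)$ the column space, $\|\cdot\|_\infty$ the maximum absolute entry. $\mathbb{R}^{k+}=\{\kappa\in\mathbb{R}^k:\kappa_1>\dots>\kappa_k>0\}$. SLOPE pattern: for $b\in\mathbb{R}^p$, $\mathrm{patt}(b)_i=\mathrm{sign}(b_i)\,\mathrm{rank}(|b|)_i$, where $k$ is the number of distinct nonzero values in $\{|b_1|,\dots,|b_p|\}$, $\mathrm{rank}(|b|)_i\in\{0,1,\dots,k\}$, $\mathrm{rank}(|b|)_i=0$ if $b_i=0$, $\mathrm{rank}(|b|)_i>0$ if $b_i\ne0$, and $\mathrm{rank}(|b|)_i<\mathrm{rank}(|b|)_j$ if $|b_i|<|b_j|$ (so $\mathrm{rank}(|b|)_i$ is the number of distinct nonzero values of $|b_1|,\dots,|b_p|$ that are $\le|b_i|$). For a pattern $M\ne0$ with $k=\|M\|_\infty$, the pattern matrix $U_M\in\mathbb{R}^{p\times k}$ is $(U_M)_{ij}=\mathrm{sign}(M_i)\mathbf 1_{(|M_i|=k+1-j)}$. $|M|_\downarrow$ is the vector of absolute values of the components of $M$ in nonincreasing order. $\tilde X_M=XU_M$ and $\tilde\Lambda_M=(U_{|M|_\downarrow})'\Lambda\in\mathbb{R}^k$. For $\Lambda=(\lambda_1,\dots,\lambda_p)'\in\mathbb{R}^{p+}$: $J_\Lambda(b)=\sum_{i=1}^p\lambda_i|b|_{(i)}$, where $|b|_{(1)}\ge\dots\ge|b|_{(p)}$ are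 the sorted absolute values of the components of $b$; the dual norm is $J^*_\Lambda(b)=\max_{1\le j\le p}\frac{\sum_{i=1}^j|b|_{(i)}}{\sum_{i=1}^j\lambda_i}$; $\partial J_\Lambda(b)=\{v\in\mathbb{R}^p: J_\Lambda(z)\ge J_\Lambda(b)+v'(z-b)\ \forall z\in\mathbb{R}^p\}$. $S_{X,\Lambda}(Y)=\arg\min_{b\in\mathbb{R}^p}\{\frac12\|Y-Xb\|_2^2+J_\Lambda(b)\}$ is the set of SLOPE minimizers. *)

theory Defs
  imports Complex_Main "Jordan_Normal_Form.VS_Connect"
begin

text \<open>
  Vectors and matrices are those of Jordan_Normal_Form, so that the number of columns of the
  pattern matrix can depend on the pattern. Indices start at 0.
\<close>

definition decreasing_pos_vecs :: "nat \<Rightarrow> real vec set" where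
  "decreasing_pos_vecs k = {v \<in> carrier_vec k.
     (\<forall>i<k. \<forall>j<k. i < j \<longrightarrow> v $ j < v $ i) \<and> (\<forall>i<k. 0 < v $ i)}"

definition linf_norm :: "'a::linordered_idom vec \<Rightarrow> 'a" where
  "linf_norm v = Max (abs ` set\<^sub>v v)"

definition abs_sorted :: "'a::linordered_idom vec \<Rightarrow> 'a vec" where
  "abs_sorted v = vec_of_list (rev (sort (map abs (list_of_vec v))))"

text \<open>The number of distinct nonzero absolute values not exceeding the i-th one.\<close>

definition abs_rank :: "real vec \<Rightarrow> nat \<Rightarrow> nat" where
  "abs_rank b i = card {a \<in> abs ` set\<^sub>v b. a \<noteq> 0 \<and> a \<le> \<bar>b $ i\<bar>}"

definition patt :: "real vec \<Rightarrow> int vec" where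
  "patt b = vec (dim_vec b) (\<lambda>i. (if b $ i < 0 then - 1 else if b $ i = 0 then 0 else 1)
                                 * int (abs_rank b i))"

text \<open>With 0-based columns the usual condition |M_i| = k + 1 - j reads |M_i| = k - j.\<close>

definition pattern_mat :: "int vec \<Rightarrow> real mat" where
  "pattern_mat M = (let k = nat (linf_norm M) in
     mat (dim_vec M) k (\<lambda>(i, j). if \<bar>M $ i\<bar> = int k - int j then real_of_int (sgn (M $ i)) else 0))"

definition clustered_mat :: "real mat \<Rightarrow> int vec \<Rightarrow> real mat" where
  "clustered_mat X M = X * pattern_mat M"

definition clustered_penalty :: "real vec \<Rightarrow> int vec \<Rightarrow> real vec" where
  "clustered_penalty \<Lambda> M = transpose_mat (pattern_mat (abs_sorted M)) *\<^sub>v \<Lambda>"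

text \<open>The Penrose equations; over the reals the adjoint is the transpose.\<close>

definition is_pseudo_inverse :: "real mat \<Rightarrow> real mat \<Rightarrow> bool" where
  "is_pseudo_inverse A B \<longleftrightarrow>
     B \<in> carrier_mat (dim_col A) (dim_row A) \<and>
     A * B * A = A \<and> B * A * B = B \<and>
     transpose_mat (A * B) = A * B \<and> transpose_mat (B * A) = B * A"

definition pseudo_inverse :: "real mat \<Rightarrow> real mat" where
  "pseudo_inverse A = (THE B. is_pseudo_inverse A B)"

definition col_space :: "real mat \<Rightarrow> real vec set" where
  "col_space A = vec_space.col_space (dim_row A) A"

definition slope_norm :: "real vec \<Rightarrow> real vec \<Rightarrow> real" where
  "slope_norm \<Lambda> b = (\<Sum>i<dim_vec b. \<Lambda> $ i * abs_sorted b $ i)"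

definition slope_dual_norm :: "real vec \<Rightarrow> real vec \<Rightarrow> real" where
  "slope_dual_norm \<Lambda> b =
     Max ((\<lambda>j. (\<Sum>i<j. abs_sorted b $ i) / (\<Sum>i<j. \<Lambda> $ i)) ` {1..dim_vec b})"

definition slope_subdifferential :: "real vec \<Rightarrow> real vec \<Rightarrow> real vec set" where
  "slope_subdifferential \<Lambda> b = {v \<in> carrier_vec (dim_vec b).
     \<forall>z \<in> carrier_vec (dim_vec b). slope_norm \<Lambda> z \<ge> slope_norm \<Lambda> b + v \<bullet> (z - b)}"

text \<open>The scalar product of the residual with itself is its squared Euclidean norm.\<close>

definition slope_objective :: "real mat \<Rightarrow> real vec \<Rightarrow> real vec \<Rightarrow> real vec \<Rightarrow> real" where
  "slope_objective X \<Lambda> Y b =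
     1 / 2 * ((Y - X *\<^sub>v b) \<bullet> (Y - X *\<^sub>v b)) + slope_norm \<Lambda> b"

definition slope_minimizers :: "real mat \<Rightarrow> real vec \<Rightarrow> real vec \<Rightarrow> real vec set" where
  "slope_minimizers X \<Lambda> Y =
     {b. is_arg_min (slope_objective X \<Lambda> Y) (\<lambda>b. b \<in> carrier_vec (dim_col X)) b}"

definition dual_certificate :: "real mat \<Rightarrow> real vec \<Rightarrow> int vec \<Rightarrow> real vec" where
  "dual_certificate X \<Lambda> M = transpose_mat X *\<^sub>v
     (pseudo_inverse (transpose_mat (clustered_mat X M)) *\<^sub>v clustered_penalty \<Lambda> M)"

end

theory Submission
  imports Defs "HOL-Combinatorics.List_Permutation"
begin

text \<open>
  Let M be the pattern of a nonzero vector \<beta>. The vectors with pattern M form a relatively open cone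
  in a linear subspace: they are the vectors U s, where U is the pattern matrix of M and s lists the
  cluster values, s_1 > ... > s_k > 0 (patt_decomposition, patt_pattern_mat_mult_cong). On this cone the sorted norm is the linear
  functional s \<mapsto> \<Lambda>~'s, where \<Lambda>~ is the clustered penalty. As the cone is open, the subdifferential is
  the same at all its points, namely the set of v in the dual unit ball with U'v = \<Lambda>~
  (slope_subdifferential_pattern_iff).

  Let \<beta> = U s and A = (XU)'. By the optimality condition, U t is a minimizer for the data X\<beta> if and
  only if X'w is in this subdifferential, where w = XU(s - t) = A'(s - t) is the residual. In
  particular A w = \<Lambda>~ with w in the row space of A, and this determines w as the image of \<Lambda>~ under the
  pseudo-inverse of A. Hence X'w is the dual certificate, whatever the minimizer with the right
  pattern is. Conversely, let the certificate be a subgradient. The pseudo-inverse maps \<Lambda>~ to some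
  A'u, and t = s - c u still lies in the open cone for small c > 0. The residual of U t is then
  c A'u, so X'w is c times the certificate and U t is a minimizer for the penalty c \<Lambda>. This gives
  minimizers and certificates for arbitrarily small penalties at once.

  The description of the subdifferential by the dual norm rests on one summation by parts
  (sum_mult_antimono_le): the sums of the j largest absolute values are maxima over index sets, and
  decreasing weights turn inequalities between these sums into inequalities for the norm.
\<close>

section \<open>Least squares and the Moore-Penrose inverse\<close>

lemma scalar_prod_self_ge_0: "0 \<le> (v :: real vec) \<bullet> v"
  by (auto simp: scalar_prod_def intro: sum_nonneg)

lemma scalar_prod_self_eq_0:
  assumes "(v :: real vec) \<in> carrier_vec n" "v \<bullet> v = 0"
  shows "v = 0\<^sub>v n"
proof (rule eq_vecI)
  fix i assume i: "i < dim_vec (0\<^sub>v n)"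
  have "\<forall>i\<in>{0..<n}. v $ i * v $ i = 0"
    using assms by (subst sum_nonneg_eq_0_iff[symmetric]) (auto simp: scalar_prod_def)
  then show "v $ i = 0\<^sub>v n $ i" using i by simp
qed (use assms in simp)

lemma vec_minus_eq_0_imp_eq:
  assumes "v \<in> carrier_vec n" "w \<in> carrier_vec n" "v - w = 0\<^sub>v n"
  shows "v = (w :: 'a :: ab_group_add vec)"
proof (rule eq_vecI)
  fix i assume "i < dim_vec w"
  moreover from this have "(v - w) $ i = 0" unfolding assms(3) using assms(2) by simp
  ultimately show "v $ i = w $ i" by simp
qed (use assms in simp)

lemma mult_mat_unit_vec:
  assumes "(A :: 'a :: comm_semiring_1 mat) \<in> carrier_mat m n" "i < n"
  shows "A *\<^sub>v unit_vec n i = col A i"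
  using assms by (intro eq_vecI) auto

text \<open>
  Least squares problems have solutions for every matrix, by the Gram-Schmidt process: the columns
  are taken into account one at a time, and the least squares approximation of the next column by
  the earlier ones supplies the direction in which the residual still has to be corrected.
\<close>

lemma normal_equations_solvable:
  fixes A :: "real mat"
  assumes A: "A \<in> carrier_mat m n" and y: "y \<in> carrier_vec m"
  shows "\<exists>x \<in> carrier_vec n. A\<^sup>T *\<^sub>v (y - A *\<^sub>v x) = 0\<^sub>v n"
proof -
  have col: "col A i \<in> carrier_vec m" if "i < n" for i using A that by auto
  \<comment> \<open>Fitting with the first j columns is fitting with coefficients that vanish from index j on.\<close>
  have "\<exists>x \<in> carrier_vec n. (\<forall>i. j \<le> i \<longrightarrow> i < n \<longrightarrow> x $ i = 0) \<and>
          (\<forall>i<j. col A i \<bullet> (y - A *\<^sub>v x) = 0)"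
    if "j \<le> n" "y \<in> carrier_vec m" for j y
    using that
  proof (induction j arbitrary: y)
    case 0
    then show ?case by (intro bexI[of _ "0\<^sub>v n"]) auto
  next
    case (Suc j)
    then have j: "j < n" by simp
    note y = \<open>y \<in> carrier_vec m\<close>
    obtain x where x: "x \<in> carrier_vec n" "\<And>i. j \<le> i \<Longrightarrow> i < n \<Longrightarrow> x $ i = 0"
        "\<And>i. i < j \<Longrightarrow> col A i \<bullet> (y - A *\<^sub>v x) = 0"
      using Suc.IH[of y] j y by (auto simp del: index_mult_mat_vec)
    obtain a where a: "a \<in> carrier_vec n" "\<And>i. j \<le> i \<Longrightarrow> i < n \<Longrightarrow> a $ i = 0"
        "\<And>i. i < j \<Longrightarrow> col A i \<bullet> (col A j - A *\<^sub>v a) = 0"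
      using Suc.IH[of "col A j"] j col by (auto simp del: index_mult_mat_vec)
    define v where "v = col A j - A *\<^sub>v a"
    have v: "v \<in> carrier_vec m" using A a j by (auto simp: v_def)
    define w where "w = y - A *\<^sub>v x"
    have w: "w \<in> carrier_vec m" using A x y by (auto simp: w_def)
    define c where "c = (v \<bullet> w) / (v \<bullet> v)"
    define x' where "x' = x + c \<cdot>\<^sub>v (unit_vec n j - a)"
    have x': "x' \<in> carrier_vec n" using x a by (auto simp: x'_def)
    have "A *\<^sub>v unit_vec n j = col A j" using A j by (simp add: mult_mat_unit_vec)
    then have "A *\<^sub>v x' = A *\<^sub>v x + c \<cdot>\<^sub>v v"
      using A x a j unfolding x'_def v_def
      by (simp add: mult_add_distrib_mat_vec[OF A] mult_mat_vec[OF A] mult_minus_distrib_mat_vec[OF A])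
    then have w': "y - A *\<^sub>v x' = w - c \<cdot>\<^sub>v v"
      using A x y v unfolding w_def by (intro eq_vecI) auto
    have old: "col A i \<bullet> (w - c \<cdot>\<^sub>v v) = 0" if "i < j" for i
      using that col[of i] j x(3)[of i] a(3)[of i] v w
      by (simp add: scalar_prod_minus_distrib[of _ m] w_def[symmetric] v_def[symmetric])
    \<comment> \<open>A a is a combination of columns to which the new residual is already orthogonal.\<close>
    have "(A *\<^sub>v a) \<bullet> (w - c \<cdot>\<^sub>v v) = (A\<^sup>T *\<^sub>v (w - c \<cdot>\<^sub>v v)) \<bullet> a"
      using A a v w
      by (subst transpose_vec_mult_scalar[OF A]) (auto intro!: comm_scalar_prod[of _ m])
    also have "\<dots> = 0"
      unfolding scalar_prod_def
    proof (rule sum.neutral, rule ballI)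
      fix i assume "i \<in> {0..<dim_vec a}"
      then have i: "i < n" using a by simp
      have "(A\<^sup>T *\<^sub>v (w - c \<cdot>\<^sub>v v)) $ i = col A i \<bullet> (w - c \<cdot>\<^sub>v v)"
        using A i by simp
      then show "(A\<^sup>T *\<^sub>v (w - c \<cdot>\<^sub>v v)) $ i * a $ i = 0"
        using old[of i] a(2)[of i] i by (cases "i < j") auto
    qed
    finally have Aa: "(A *\<^sub>v a) \<bullet> (w - c \<cdot>\<^sub>v v) = 0" .
    \<comment> \<open>If v vanishes, column j depends on the earlier ones and no correction is needed; the
      quotient c is then 0.\<close>
    have "v \<bullet> (w - c \<cdot>\<^sub>v v) = 0"
    proof (cases "v \<bullet> v = 0")
      case True
      then show ?thesis using scalar_prod_self_eq_0[OF v] v w by auto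
    next
      case False
      then show ?thesis using v w
        by (simp add: scalar_prod_minus_distrib[of _ m] c_def)
    qed
    moreover have "col A j = v + A *\<^sub>v a"
      using A a j unfolding v_def by (intro eq_vecI) auto
    ultimately have "col A j \<bullet> (w - c \<cdot>\<^sub>v v) = 0"
      using Aa A a v w by (simp add: add_scalar_prod_distrib[of _ m])
    then have "\<forall>i<Suc j. col A i \<bullet> (y - A *\<^sub>v x') = 0"
      using old w' by (auto simp: less_Suc_eq)
    moreover have "\<forall>i. Suc j \<le> i \<longrightarrow> i < n \<longrightarrow> x' $ i = 0"
      using x a by (auto simp: x'_def)
    ultimately show ?case using x' by blast
  qed
  from this[of n y] y obtain x where "x \<in> carrier_vec n"
      "\<And>i. i < n \<Longrightarrow> col A i \<bullet> (y - A *\<^sub>v x) = 0"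
    by auto
  then show ?thesis using A
    by (intro bexI[of _ x] eq_vecI) auto
qed

text \<open>
  The columns of C are least squares solutions for the unit vectors, so A C is the orthogonal
  projection onto the column space of A. Algebraically, the normal equations A'AC = A' make
  (AC)'(AC) = (AC)', and the left-hand side is symmetric.
\<close>

lemma least_squares_inverse_exists:
  fixes A :: "real mat"
  assumes A: "A \<in> carrier_mat m n"
  shows "\<exists>C \<in> carrier_mat n m. A * C * A = A \<and> (A * C)\<^sup>T = A * C"
proof -
  have "\<exists>x. \<forall>i. i < m \<longrightarrow> x i \<in> carrier_vec n \<and> A\<^sup>T *\<^sub>v (unit_vec m i - A *\<^sub>v x i) = 0\<^sub>v n"
    using normal_equations_solvable[OF A unit_vec_carrier] by (intro choice) blast
  then obtain x where x: "\<And>i. i < m \<Longrightarrow> x i \<in> carrier_vec n"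
      "\<And>i. i < m \<Longrightarrow> A\<^sup>T *\<^sub>v (unit_vec m i - A *\<^sub>v x i) = 0\<^sub>v n" by auto
  define C where "C = mat_of_cols n (map x [0..<m])"
  have C: "C \<in> carrier_mat n m" by (simp add: C_def mat_of_cols_def)
  have colC: "col C i = x i" if "i < m" for i
    using that x(1)[of i] unfolding C_def by (subst col_mat_of_cols) auto
  have normal: "A\<^sup>T * (A * C) = A\<^sup>T"
  proof (rule mat_col_eqI)
    fix i assume "i < dim_col A\<^sup>T"
    then have i: "i < m" using A by simp
    have "A\<^sup>T *\<^sub>v unit_vec m i - A\<^sup>T *\<^sub>v (A *\<^sub>v x i) = 0\<^sub>v n"
      using x[OF i] A by (simp add: mult_minus_distrib_mat_vec[of _ n m])
    moreover have "A\<^sup>T *\<^sub>v unit_vec m i \<in> carrier_vec n" "A\<^sup>T *\<^sub>v (A *\<^sub>v x i) \<in> carrier_vec n"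
      using A x(1)[OF i] by auto
    ultimately have eq: "A\<^sup>T *\<^sub>v (A *\<^sub>v x i) = A\<^sup>T *\<^sub>v unit_vec m i"
      by (metis vec_minus_eq_0_imp_eq)
    have "col (A\<^sup>T * (A * C)) i = A\<^sup>T *\<^sub>v (A *\<^sub>v x i)"
      using col_mult2[OF transpose_carrier_mat[THEN iffD2, OF A] mult_carrier_mat[OF A C] i]
        col_mult2[OF A C i] colC[OF i] by simp
    also have "\<dots> = col A\<^sup>T i"
      unfolding eq using A i by (simp add: mult_mat_unit_vec)
    finally show "col (A\<^sup>T * (A * C)) i = col A\<^sup>T i" .
  qed (use A C in auto)
  have "(A * C)\<^sup>T * (A * C) = C\<^sup>T * (A\<^sup>T * (A * C))"
    using A C by (simp add: transpose_mult[OF A C] assoc_mult_mat[of _ m n _ m _ m])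
  then have gram: "(A * C)\<^sup>T * (A * C) = (A * C)\<^sup>T"
    unfolding normal by (simp add: transpose_mult[OF A C])
  have "((A * C)\<^sup>T * (A * C))\<^sup>T = (A * C)\<^sup>T * (A * C)"
    using A C by (subst transpose_mult[of _ m m _ m]) auto
  then have sym: "(A * C)\<^sup>T = A * C" unfolding gram by simp
  have "(A\<^sup>T * (A * C))\<^sup>T = (A * C)\<^sup>T * A"
    using A C by (simp add: transpose_mult[of "A\<^sup>T" n m "A * C" m])
  then have "A * C * A = A" unfolding normal sym by simp
  then show ?thesis using C sym by auto
qed

text \<open>
  If C inverts A in the least squares sense and the transpose of D does so for the transpose of A,
  then A C projects onto the column space of A, D A projects onto its row space, and D A C satisfies
  all four Penrose equations.
\<close>

lemma pseudo_inverse_exists: "\<exists>B. is_pseudo_inverse A B"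
proof -
  define m n where "m = dim_row A" and "n = dim_col A"
  have A: "A \<in> carrier_mat m n" by (simp add: m_def n_def)
  obtain C where C: "C \<in> carrier_mat n m" "A * C * A = A" "(A * C)\<^sup>T = A * C"
    using least_squares_inverse_exists[OF A] by auto
  obtain D' where D': "D' \<in> carrier_mat m n" "A\<^sup>T * D' * A\<^sup>T = A\<^sup>T" "(A\<^sup>T * D')\<^sup>T = A\<^sup>T * D'"
    using least_squares_inverse_exists[of "A\<^sup>T" n m] A by auto
  define D where "D = D'\<^sup>T"
  have D: "D \<in> carrier_mat n m" using D' by (simp add: D_def)
  have DA: "D * A = A\<^sup>T * D'"
    using D'(1,3) A by (simp add: D_def transpose_mult[of _ n m _ n])
  have "(A\<^sup>T * D' * A\<^sup>T)\<^sup>T = A * (A\<^sup>T * D')"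
    using A D' by (subst transpose_mult[of _ n n _ m]) auto
  then have ADA: "A * (D * A) = A" unfolding D'(2) DA by simp
  let ?B = "D * (A * C)"
  have AB: "A * ?B = A * C"
  proof -
    have "A * ?B = A * (D * A) * C"
      using A C D by (simp add: assoc_mult_mat[of _ m n _ m _ m] assoc_mult_mat[of _ m n _ n _ m] assoc_mult_mat[of _ n m _ n _ m])
    then show ?thesis by (simp add: ADA)
  qed
  have BA: "?B * A = D * A"
    using A C D by (simp add: assoc_mult_mat[of D n m "A * C" m A n])
  have "?B * A * ?B = D * (A * ?B)"
    unfolding BA using A C D by (simp add: assoc_mult_mat[of D n m A n _ m])
  also have "\<dots> = ?B" unfolding AB ..
  finally have BAB: "?B * A * ?B = ?B" .
  have "is_pseudo_inverse A ?B"
    unfolding is_pseudo_inverse_def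
  proof (intro conjI)
    show "?B \<in> carrier_mat (dim_col A) (dim_row A)" using A C D by auto
    show "A * ?B * A = A" unfolding AB by (fact C)
    show "?B * A * ?B = ?B" by (fact BAB)
    show "(A * ?B)\<^sup>T = A * ?B" unfolding AB by (fact C)
    show "(?B * A)\<^sup>T = ?B * A" unfolding BA DA by (fact D')
  qed
  then show ?thesis ..
qed

text \<open>
  A B and A C are symmetric and both project onto the column space of A, so they agree; likewise
  B A and C A. The remaining equations recover B and C from these projections.
\<close>

lemma pseudo_inverse_unique:
  assumes "is_pseudo_inverse A B" "is_pseudo_inverse A C"
  shows "B = C"
proof -
  define m n where "m = dim_row A" and "n = dim_col A"
  have A: "A \<in> carrier_mat m n" by (simp add: m_def n_def)
  have B: "B \<in> carrier_mat n m" "A * B * A = A" "B * A * B = B"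
      "(A * B)\<^sup>T = A * B" "(B * A)\<^sup>T = B * A"
    and C: "C \<in> carrier_mat n m" "A * C * A = A" "C * A * C = C"
      "(A * C)\<^sup>T = A * C" "(C * A)\<^sup>T = C * A"
    using assms by (simp_all only: is_pseudo_inverse_def m_def n_def)
  note AB = mult_carrier_mat[OF A B(1)] and AC = mult_carrier_mat[OF A C(1)]
    and BA = mult_carrier_mat[OF B(1) A] and CA = mult_carrier_mat[OF C(1) A]
  have "(A * C) * (A * B) = A * B" "(A * B) * (A * C) = A * C"
    using assoc_mult_mat[OF AC A B(1)] assoc_mult_mat[OF AB A C(1)] by (simp_all only: B C)
  then have left: "A * B = A * C"
    using transpose_mult[OF AC AB] by (simp only: B C)
  have "(B * A) * (C * A) = B * A" "(C * A) * (B * A) = C * A"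
    using assoc_mult_mat[OF B(1) A CA] assoc_mult_mat[OF C(1) A BA]
      assoc_mult_mat[OF A C(1) A] assoc_mult_mat[OF A B(1) A] by (simp_all only: B C)
  then have right: "B * A = C * A"
    using transpose_mult[OF BA CA] by (simp only: B C)
  have "B = (B * A) * B" by (simp only: B)
  also have "\<dots> = C * (A * B)"
    unfolding right by (rule assoc_mult_mat[OF C(1) A B(1)])
  also have "\<dots> = C * A * C"
    unfolding left by (rule assoc_mult_mat[OF C(1) A C(1), symmetric])
  also have "\<dots> = C" by (fact C)
  finally show ?thesis .
qed

lemma is_pseudo_inverse_pseudo_inverse: "is_pseudo_inverse A (pseudo_inverse A)"
  unfolding pseudo_inverse_def
  using pseudo_inverse_exists[of A] pseudo_inverse_unique by (metis (no_types) theI)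

text \<open>
  P A is the orthogonal projection onto the row space of A: it fixes every vector A'u.
\<close>

lemma pseudo_inverse_row_space:
  assumes P: "is_pseudo_inverse A P" and A: "A \<in> carrier_mat k n" and u: "u \<in> carrier_vec k"
  shows "P *\<^sub>v (A *\<^sub>v (A\<^sup>T *\<^sub>v u)) = A\<^sup>T *\<^sub>v u"
proof -
  have Pc: "P \<in> carrier_mat n k" and eq: "A * P * A = A" "(P * A)\<^sup>T = P * A"
    using P A by (auto simp: is_pseudo_inverse_def)
  have PA: "P * A \<in> carrier_mat n n" using Pc A by simp
  have At: "A\<^sup>T \<in> carrier_mat n k" using A by simp
  have "(P * A) * A\<^sup>T = (A * (P * A))\<^sup>T"
    using transpose_mult[OF A PA] eq(2) by simp
  also have "A * (P * A) = A" using assoc_mult_mat[OF A Pc A] eq(1) by simp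
  finally have "(P * A) * A\<^sup>T = A\<^sup>T" .
  then show ?thesis
    using assoc_mult_mat_vec[OF PA At u] assoc_mult_mat_vec[OF Pc A, of "A\<^sup>T *\<^sub>v u"] At u
    by simp
qed

text \<open>
  P = (PA)'P = A'P'P, so the range of P lies in the row space of A.
\<close>

lemma pseudo_inverse_mult_in_row_space:
  assumes P: "is_pseudo_inverse A P" and A: "A \<in> carrier_mat k n" and w: "w \<in> carrier_vec k"
  shows "\<exists>u \<in> carrier_vec k. P *\<^sub>v w = A\<^sup>T *\<^sub>v u"
proof -
  have Pc: "P \<in> carrier_mat n k" and eq: "P * A * P = P" "(P * A)\<^sup>T = P * A"
    using P A by (auto simp: is_pseudo_inverse_def)
  have At: "A\<^sup>T \<in> carrier_mat n k" and Pt: "P\<^sup>T \<in> carrier_mat k n" using A Pc by auto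
  have "P *\<^sub>v w = (A\<^sup>T * P\<^sup>T * P) *\<^sub>v w"
    using transpose_mult[OF Pc A] eq by simp
  also have "\<dots> = A\<^sup>T *\<^sub>v (P\<^sup>T *\<^sub>v (P *\<^sub>v w))"
    using assoc_mult_mat_vec[OF mult_carrier_mat[OF At Pt] Pc w]
      assoc_mult_mat_vec[OF At Pt mult_mat_vec_carrier[OF Pc w]] by simp
  finally show ?thesis using Pt Pc w by (intro bexI[of _ "P\<^sup>T *\<^sub>v (P *\<^sub>v w)"]) auto
qed

section \<open>Sums of the largest absolute values\<close>

lemma decreasing_pos_vecsD:
  assumes "v \<in> decreasing_pos_vecs k"
  shows "v \<in> carrier_vec k" "\<And>i. i < k \<Longrightarrow> 0 < v $ i"
    "\<And>i j. i < j \<Longrightarrow> j < k \<Longrightarrow> v $ j < v $ i"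
    "\<And>i j. i \<le> j \<Longrightarrow> j < k \<Longrightarrow> v $ j \<le> v $ i"
  using assms unfolding decreasing_pos_vecs_def by (auto simp: le_less)

text \<open>
  Summation by parts: the weights c are nonnegative combinations of the indicators of initial
  segments, so it suffices to compare partial sums. It is applied both with the penalties and with
  sorted absolute values as weights.
\<close>

lemma sum_mult_antimono_le:
  fixes a b c :: "nat \<Rightarrow> real"
  assumes part: "\<And>j. j \<le> p \<Longrightarrow> (\<Sum>i<j. a i) \<le> (\<Sum>i<j. b i)"
    and anti: "\<And>i j. i \<le> j \<Longrightarrow> j < p \<Longrightarrow> c j \<le> c i"
    and nonneg: "\<And>i. i < p \<Longrightarrow> 0 \<le> c i"
  shows "(\<Sum>i<p. c i * a i) \<le> (\<Sum>i<p. c i * b i)"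
proof (cases p)
  case (Suc q)
  define d where "d j = (\<Sum>i<j. b i - a i)" for j
  have d: "0 \<le> d j" if "j \<le> p" for j
    using part[OF that] by (simp add: d_def sum_subtractf)
  \<comment> \<open>The claim for p needs a remainder term to be inductive: the last weight times the difference
    of the partial sums.\<close>
  have "c n * d (Suc n) \<le> (\<Sum>i<Suc n. c i * (b i - a i))" if "n < p" for n
    using that
  proof (induction n)
    case 0
    then show ?case by (simp add: d_def)
  next
    case (Suc n)
    have "c (Suc n) * d (Suc (Suc n)) = c (Suc n) * d (Suc n) + c (Suc n) * (b (Suc n) - a (Suc n))"
      by (simp add: d_def algebra_simps)
    also have "c (Suc n) * d (Suc n) \<le> c n * d (Suc n)"
      using Suc.prems by (intro mult_right_mono anti d) auto
    also have "c n * d (Suc n) \<le> (\<Sum>i<Suc n. c i * (b i - a i))"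
      using Suc by simp
    finally show ?case by simp
  qed
  from this[of q] have "0 \<le> (\<Sum>i<p. c i * (b i - a i))"
    using nonneg[of q] d[of p] Suc by (auto intro: order_trans[OF mult_nonneg_nonneg])
  then show ?thesis by (simp add: algebra_simps sum_subtractf)
qed simp

lemma dim_abs_sorted [simp]: "dim_vec (abs_sorted b) = dim_vec b"
  by (simp add: abs_sorted_def)

lemma abs_sorted_permutation:
  "\<exists>f. bij_betw f {..<dim_vec b} {..<dim_vec b} \<and> (\<forall>i<dim_vec b. abs_sorted b $ i = \<bar>b $ f i\<bar>)"
proof -
  let ?xs = "rev (sort (map abs (list_of_vec b)))"
  have "mset ?xs = mset (map abs (list_of_vec b))" by simp
  then obtain f where "bij_betw f {..<length ?xs} {..<length (map abs (list_of_vec b))}"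
      "\<forall>i<length ?xs. ?xs ! i = map abs (list_of_vec b) ! f i"
    using permutation_Ex_bij by blast
  moreover from this have "f i < dim_vec b" if "i < dim_vec b" for i
    using that by (auto simp: bij_betw_def)
  ultimately show ?thesis
    by (intro exI[of _ f]) (auto simp: abs_sorted_def vec_of_list_index)
qed

lemma abs_sorted_nonneg: "i < dim_vec b \<Longrightarrow> 0 \<le> abs_sorted b $ i"
  using abs_sorted_permutation[of b] by auto

lemma abs_sorted_antimono:
  "i \<le> j \<Longrightarrow> j < dim_vec b \<Longrightarrow> abs_sorted b $ j \<le> abs_sorted b $ i"
proof -
  assume "i \<le> j" "j < dim_vec b"
  then show ?thesis
    by (auto simp: abs_sorted_def vec_of_list_index rev_nth intro!: sorted_nth_mono)
qed

lemma abs_sorted_mono_image: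
  fixes b :: "'a :: linordered_idom vec" and c :: "'b :: linordered_idom vec"
  assumes dim: "dim_vec c = dim_vec b"
    and eq: "\<And>i. i < dim_vec b \<Longrightarrow> \<bar>c $ i\<bar> = g \<bar>b $ i\<bar>"
    and mono: "mono_on (abs ` set\<^sub>v b) g"
  shows "abs_sorted c = map_vec g (abs_sorted b)"
proof -
  have map: "map abs (list_of_vec c) = map g (map abs (list_of_vec b))"
    using dim eq by (intro nth_equalityI) auto
  have "sort (map g (map abs (list_of_vec b))) = map g (sort (map abs (list_of_vec b)))"
  proof (rule properties_for_sort)
    show "sorted (map g (sort (map abs (list_of_vec b))))"
      using mono by (intro sorted_map_mono) (auto simp: set_list_of_vec)
  qed (simp add: multiset.map_comp)
  then show ?thesis
    unfolding abs_sorted_def map by (simp add: rev_map)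
qed

lemma antimono_sum_le_initial_sum:
  fixes s :: "nat \<Rightarrow> real"
  assumes anti: "\<And>i j. i \<le> j \<Longrightarrow> j < p \<Longrightarrow> s j \<le> s i"
  shows "J \<subseteq> {..<p} \<Longrightarrow> card J = j \<Longrightarrow> sum s J \<le> (\<Sum>i<j. s i)"
proof (induction j arbitrary: J)
  case 0
  then have "J = {}" using finite_subset by fastforce
  then show ?case by simp
next
  case (Suc j)
  have fin: "finite J" and ne: "J \<noteq> {}" using Suc.prems by (auto intro: card_ge_0_finite)
  define m where "m = Max J"
  have m: "m \<in> J" "m < p" using fin ne Suc.prems by (auto simp: m_def)
  have "J \<subseteq> {..m}" using fin by (auto simp: m_def)
  then have "card J \<le> Suc m" using card_mono[of "{..m}" J] by simp
  then have "j \<le> m" using Suc.prems by simp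
  have "sum s J = s m + sum s (J - {m})" using fin m by (simp add: sum.remove)
  also have "\<dots> \<le> s j + (\<Sum>i<j. s i)"
    using Suc.prems m fin \<open>j \<le> m\<close> by (intro add_mono Suc.IH anti) auto
  finally show ?case by simp
qed

text \<open>
  Together with the next lemma: the sum of the j leading entries of the sorted vector is the maximum
  of the sums of absolute values over index sets of size j. In this form it can be compared between
  vectors that are sorted by different permutations.
\<close>

lemma sum_abs_le_sum_abs_sorted:
  assumes "I \<subseteq> {..<dim_vec b}"
  shows "(\<Sum>i\<in>I. \<bar>b $ i\<bar>) \<le> (\<Sum>i<card I. abs_sorted (b :: real vec) $ i)"
proof -
  obtain f where f: "bij_betw f {..<dim_vec b} {..<dim_vec b}"
      "\<And>i. i < dim_vec b \<Longrightarrow> abs_sorted b $ i = \<bar>b $ f i\<bar>"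
    using abs_sorted_permutation by blast
  obtain J where J: "J \<subseteq> {..<dim_vec b}" "f ` J = I"
    using assms f(1) by (metis bij_betw_imp_surj_on subset_imageE)
  have inj: "inj_on f J" using f(1) J(1) by (meson bij_betw_imp_inj_on inj_on_subset)
  have "(\<Sum>i\<in>I. \<bar>b $ i\<bar>) = (\<Sum>i\<in>J. \<bar>b $ f i\<bar>)"
    using sum.reindex[OF inj] J(2) by simp
  also have "\<dots> = (\<Sum>i\<in>J. abs_sorted b $ i)"
    using J(1) f(2) by (intro sum.cong) auto
  also have "\<dots> \<le> (\<Sum>i<card I. abs_sorted b $ i)"
    using J card_image[OF inj] by (intro antimono_sum_le_initial_sum[of "dim_vec b"] abs_sorted_antimono) auto
  finally show ?thesis .
qed

lemma sum_abs_sorted_attained: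
  assumes "j \<le> dim_vec b"
  shows "\<exists>I \<subseteq> {..<dim_vec b}. card I = j \<and> (\<Sum>i<j. abs_sorted (b :: real vec) $ i) = (\<Sum>i\<in>I. \<bar>b $ i\<bar>)"
proof -
  obtain f where f: "bij_betw f {..<dim_vec b} {..<dim_vec b}"
      "\<And>i. i < dim_vec b \<Longrightarrow> abs_sorted b $ i = \<bar>b $ f i\<bar>"
    using abs_sorted_permutation by blast
  have inj: "inj_on f {..<j}" using f(1) assms by (auto simp: bij_betw_def intro: inj_on_subset)
  have "(\<Sum>i<j. abs_sorted b $ i) = (\<Sum>i\<in>f ` {..<j}. \<bar>b $ i\<bar>)"
    using f(2) assms by (simp add: sum.reindex[OF inj])
  moreover have "f ` {..<j} \<subseteq> {..<dim_vec b}" using f(1) assms by (auto simp: bij_betw_def)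
  ultimately show ?thesis using card_image[OF inj] by (intro exI[of _ "f ` {..<j}"]) auto
qed

section \<open>The sorted norm and its dual ball\<close>

text \<open>
  Each partial sum of the sorted absolute values is a maximum of sums of absolute values, hence
  subadditive; summation by parts against the decreasing penalties carries this over to the norm.
\<close>

lemma slope_norm_add_le:
  assumes L: "\<Lambda> \<in> decreasing_pos_vecs p" and b: "b \<in> carrier_vec p" and c: "c \<in> carrier_vec p"
  shows "slope_norm \<Lambda> (b + c) \<le> slope_norm \<Lambda> b + slope_norm \<Lambda> c"
proof -
  have "(\<Sum>i<p. \<Lambda> $ i * abs_sorted (b + c) $ i)
      \<le> (\<Sum>i<p. \<Lambda> $ i * (abs_sorted b $ i + abs_sorted c $ i))"
  proof (rule sum_mult_antimono_le)
    fix j assume j: "j \<le> p"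
    obtain I where I: "I \<subseteq> {..<p}" "card I = j"
        "(\<Sum>i<j. abs_sorted (b + c) $ i) = (\<Sum>i\<in>I. \<bar>(b + c) $ i\<bar>)"
      using sum_abs_sorted_attained[of j "b + c"] j b c by auto
    have "(\<Sum>i\<in>I. \<bar>(b + c) $ i\<bar>) \<le> (\<Sum>i\<in>I. \<bar>b $ i\<bar> + \<bar>c $ i\<bar>)"
      using I(1) b c by (intro sum_mono) auto
    also have "\<dots> \<le> (\<Sum>i<j. abs_sorted b $ i) + (\<Sum>i<j. abs_sorted c $ i)"
      using I(1,2) b c sum_abs_le_sum_abs_sorted[of I b] sum_abs_le_sum_abs_sorted[of I c]
      by (simp add: sum.distrib)
    finally show "(\<Sum>i<j. abs_sorted (b + c) $ i) \<le> (\<Sum>i<j. abs_sorted b $ i + abs_sorted c $ i)"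
      unfolding I(3) by (simp add: sum.distrib)
  qed (use decreasing_pos_vecsD[OF L] in \<open>auto intro: less_imp_le\<close>)
  then show ?thesis
    using b c by (simp add: slope_norm_def algebra_simps sum.distrib)
qed

lemma slope_norm_smult:
  assumes "0 \<le> t"
  shows "slope_norm \<Lambda> (t \<cdot>\<^sub>v b) = t * slope_norm \<Lambda> b"
proof -
  have "abs_sorted (t \<cdot>\<^sub>v b) = map_vec ((*) t) (abs_sorted b)"
    using assms by (intro abs_sorted_mono_image) (auto simp: abs_mult mono_on_def mult_left_mono)
  then show ?thesis by (simp add: slope_norm_def sum_distrib_left algebra_simps)
qed

lemma slope_norm_smult_penalty:
  "\<Lambda> \<in> carrier_vec (dim_vec b) \<Longrightarrow> slope_norm (t \<cdot>\<^sub>v \<Lambda>) b = t * slope_norm \<Lambda> b"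
  by (simp add: slope_norm_def sum_distrib_left algebra_simps)

lemma slope_norm_convex:
  assumes L: "\<Lambda> \<in> decreasing_pos_vecs p" and b: "b \<in> carrier_vec p" and z: "z \<in> carrier_vec p"
    and t: "0 \<le> t" "t \<le> 1"
  shows "slope_norm \<Lambda> (b + t \<cdot>\<^sub>v (z - b)) \<le> (1 - t) * slope_norm \<Lambda> b + t * slope_norm \<Lambda> z"
proof -
  have "b + t \<cdot>\<^sub>v (z - b) = (1 - t) \<cdot>\<^sub>v b + t \<cdot>\<^sub>v z"
    using b z by (intro eq_vecI) (auto simp: algebra_simps)
  then show ?thesis
    using slope_norm_add_le[OF L, of "(1 - t) \<cdot>\<^sub>v b" "t \<cdot>\<^sub>v z"] b z t
    by (simp add: slope_norm_smult)
qed

lemma slope_dual_norm_le_1_iff: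
  assumes L: "\<Lambda> \<in> decreasing_pos_vecs p" and v: "v \<in> carrier_vec p" and p: "0 < p"
  shows "slope_dual_norm \<Lambda> v \<le> 1 \<longleftrightarrow>
    (\<forall>j\<le>p. (\<Sum>i<j. abs_sorted v $ i) \<le> (\<Sum>i<j. \<Lambda> $ i))"
proof -
  have pos: "0 < (\<Sum>i<j. \<Lambda> $ i)" if "j \<in> {1..p}" for j
    using that decreasing_pos_vecsD(2)[OF L] by (intro sum_pos) (auto simp: lessThan_empty_iff)
  have "slope_dual_norm \<Lambda> v \<le> 1 \<longleftrightarrow>
      (\<forall>j\<in>{1..p}. (\<Sum>i<j. abs_sorted v $ i) / (\<Sum>i<j. \<Lambda> $ i) \<le> 1)"
    using v p unfolding slope_dual_norm_def by (subst Max_le_iff) auto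
  also have "\<dots> \<longleftrightarrow> (\<forall>j\<in>{1..p}. (\<Sum>i<j. abs_sorted v $ i) \<le> (\<Sum>i<j. \<Lambda> $ i))"
    by (intro ball_cong refl) (simp only: divide_le_eq_1_pos pos)
  also have "\<dots> \<longleftrightarrow> (\<forall>j\<le>p. (\<Sum>i<j. abs_sorted v $ i) \<le> (\<Sum>i<j. \<Lambda> $ i))"
  proof (intro iffI allI impI ballI)
    fix j assume *: "\<forall>j\<in>{1..p}. (\<Sum>i<j. abs_sorted v $ i) \<le> (\<Sum>i<j. \<Lambda> $ i)" "j \<le> p"
    then show "(\<Sum>i<j. abs_sorted v $ i) \<le> (\<Sum>i<j. \<Lambda> $ i)"
      by (cases "j = 0") auto
  qed auto
  finally show ?thesis .
qed

text \<open>
  Reading both vectors in an order that sorts z, the partial sums of the reordered absolute values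
  of v are bounded by the sums of its largest absolute values, hence by those of the penalties;
  summation by parts against the sorted absolute values of z gives the bound.
\<close>

lemma scalar_prod_le_slope_norm:
  assumes L: "\<Lambda> \<in> decreasing_pos_vecs p" and v: "v \<in> carrier_vec p" and z: "z \<in> carrier_vec p"
    and part: "\<And>j. j \<le> p \<Longrightarrow> (\<Sum>i<j. abs_sorted v $ i) \<le> (\<Sum>i<j. \<Lambda> $ i)"
  shows "v \<bullet> z \<le> slope_norm \<Lambda> z"
proof -
  obtain f where f: "bij_betw f {..<p} {..<p}" "\<And>i. i < p \<Longrightarrow> abs_sorted z $ i = \<bar>z $ f i\<bar>"
    using abs_sorted_permutation[of z] z by auto
  have "v \<bullet> z = (\<Sum>i<p. v $ i * z $ i)"
    using z by (auto simp: scalar_prod_def atLeast0LessThan)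
  also have "\<dots> \<le> (\<Sum>i<p. \<bar>v $ i\<bar> * \<bar>z $ i\<bar>)"
    by (intro sum_mono) (simp flip: abs_mult)
  also have "\<dots> = (\<Sum>i<p. \<bar>v $ f i\<bar> * \<bar>z $ f i\<bar>)"
    by (rule sum.reindex_bij_betw[OF f(1), symmetric])
  also have "\<dots> = (\<Sum>i<p. abs_sorted z $ i * \<bar>v $ f i\<bar>)"
    using f(2) by (intro sum.cong) auto
  also have "\<dots> \<le> (\<Sum>i<p. abs_sorted z $ i * \<Lambda> $ i)"
  proof (rule sum_mult_antimono_le)
    fix j assume j: "j \<le> p"
    have inj: "inj_on f {..<j}" using f(1) j by (auto simp: bij_betw_def intro: inj_on_subset)
    have sub: "f ` {..<j} \<subseteq> {..<p}" using f(1) j by (auto simp: bij_betw_def)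
    have "(\<Sum>i<j. \<bar>v $ f i\<bar>) = (\<Sum>i\<in>f ` {..<j}. \<bar>v $ i\<bar>)"
      by (simp add: sum.reindex[OF inj])
    also have "\<dots> \<le> (\<Sum>i<j. abs_sorted v $ i)"
      using sum_abs_le_sum_abs_sorted[of "f ` {..<j}" v] sub v card_image[OF inj] by simp
    also have "\<dots> \<le> (\<Sum>i<j. \<Lambda> $ i)" by (rule part[OF j])
    finally show "(\<Sum>i<j. \<bar>v $ f i\<bar>) \<le> (\<Sum>i<j. \<Lambda> $ i)" .
  qed (use z abs_sorted_antimono[of _ _ z] abs_sorted_nonneg[of _ z] in auto)
  finally show ?thesis using z by (simp add: slope_norm_def mult.commute)
qed

text \<open>
  The test vector is the sign pattern of v on an index set carrying the j largest absolute values: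
  its pairing with v is the j-th partial sum, and its norm is the sum of the j largest penalties.
\<close>

lemma partial_sums_le_if_scalar_prod_le_slope_norm:
  assumes L: "\<Lambda> \<in> decreasing_pos_vecs p" and v: "v \<in> carrier_vec p"
    and le: "\<And>z. z \<in> carrier_vec p \<Longrightarrow> v \<bullet> z \<le> slope_norm \<Lambda> z" and j: "j \<le> p"
  shows "(\<Sum>i<j. abs_sorted v $ i) \<le> (\<Sum>i<j. \<Lambda> $ i)"
proof -
  obtain I where I: "I \<subseteq> {..<p}" "card I = j"
      "(\<Sum>i<j. abs_sorted v $ i) = (\<Sum>i\<in>I. \<bar>v $ i\<bar>)"
    using sum_abs_sorted_attained[of j v] j v by auto
  define z where "z = vec p (\<lambda>i. if i \<in> I then if v $ i < 0 then -1 else 1 else 0 :: real)"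
  have z: "z \<in> carrier_vec p" by (simp add: z_def)
  have "(\<Sum>i\<in>I. \<bar>v $ i\<bar>) = (\<Sum>i<p. if i \<in> I then \<bar>v $ i\<bar> else 0)"
    using I(1) by (simp add: sum.If_cases Int_absorb1)
  also have "\<dots> = (\<Sum>i<p. v $ i * z $ i)"
    by (intro sum.cong) (auto simp: z_def)
  also have "\<dots> = v \<bullet> z" using z by (auto simp: scalar_prod_def atLeast0LessThan)
  also have "\<dots> \<le> slope_norm \<Lambda> z" by (rule le[OF z])
  also have "\<dots> = (\<Sum>i<p. \<Lambda> $ i * abs_sorted z $ i)"
    using z by (simp add: slope_norm_def)
  \<comment> \<open>Since z takes j values of modulus 1 and otherwise 0, the sorted z is the indicator of the
    first j indices; an upper bound in terms of partial sums is enough here.\<close>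
  also have "\<dots> \<le> (\<Sum>i<p. \<Lambda> $ i * (if i < j then 1 else 0))"
  proof (rule sum_mult_antimono_le)
    fix m assume m: "m \<le> p"
    obtain K where K: "K \<subseteq> {..<p}" "card K = m"
        "(\<Sum>i<m. abs_sorted z $ i) = (\<Sum>i\<in>K. \<bar>z $ i\<bar>)"
      using sum_abs_sorted_attained[of m z] m z by auto
    have fin: "finite I" "finite K" using I(1) K(1) by (auto intro: finite_subset)
    have "(\<Sum>i\<in>K. \<bar>z $ i\<bar>) = (\<Sum>i\<in>K. if i \<in> I then 1 else 0)"
      using K(1) by (intro sum.cong) (auto simp: z_def)
    also have "\<dots> = real (card (K \<inter> I))" using fin by (simp add: sum.If_cases)
    also have "\<dots> \<le> real (min m j)"
      using fin card_mono[of I "K \<inter> I"] card_mono[of K "K \<inter> I"] I(2) K(2) by auto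
    also have "\<dots> = (\<Sum>i<m. if i < j then 1 else 0)"
    proof -
      have "{..<m} \<inter> {i. i < j} = {..<min m j}" by auto
      then show ?thesis by (simp add: sum.If_cases)
    qed
    finally show "(\<Sum>i<m. abs_sorted z $ i) \<le> (\<Sum>i<m. if i < j then 1 else 0)"
      unfolding K(3) .
  qed (use decreasing_pos_vecsD[OF L] in \<open>auto intro: less_imp_le\<close>)
  also have "\<dots> = (\<Sum>i<j. \<Lambda> $ i)"
  proof -
    have "(\<Sum>i<p. \<Lambda> $ i * (if i < j then 1 else 0)) = (\<Sum>i<p. if i < j then \<Lambda> $ i else 0)"
      by (intro sum.cong) auto
    moreover have "{..<p} \<inter> {i. i < j} = {..<j}" using j by auto
    ultimately show ?thesis by (simp add: sum.If_cases)
  qed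
  finally show ?thesis unfolding I(3) .
qed

lemma slope_dual_ball_iff:
  assumes "\<Lambda> \<in> decreasing_pos_vecs p" "v \<in> carrier_vec p" "0 < p"
  shows "slope_dual_norm \<Lambda> v \<le> 1 \<longleftrightarrow> (\<forall>z \<in> carrier_vec p. v \<bullet> z \<le> slope_norm \<Lambda> z)"
  using assms scalar_prod_le_slope_norm partial_sums_le_if_scalar_prod_le_slope_norm
  by (metis slope_dual_norm_le_1_iff)

text \<open>
  This holds for any norm: testing the subgradient inequality at the multiples 0 and 2b of b gives
  v'b = J(b), and the inequality then says that v lies in the dual ball.
\<close>

lemma slope_subdifferential_iff:
  assumes L: "\<Lambda> \<in> decreasing_pos_vecs p" and p: "0 < p" and b: "b \<in> carrier_vec p"
  shows "v \<in> slope_subdifferential \<Lambda> b \<longleftrightarrow>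
    v \<in> carrier_vec p \<and> slope_dual_norm \<Lambda> v \<le> 1 \<and> v \<bullet> b = slope_norm \<Lambda> b"
proof (cases "v \<in> carrier_vec p")
  case v: True
  have sub: "v \<in> slope_subdifferential \<Lambda> b \<longleftrightarrow>
      (\<forall>z \<in> carrier_vec p. slope_norm \<Lambda> b + (v \<bullet> z - v \<bullet> b) \<le> slope_norm \<Lambda> z)"
    using v b by (auto simp: slope_subdifferential_def scalar_prod_minus_distrib[of _ p])
  have "(\<forall>z \<in> carrier_vec p. slope_norm \<Lambda> b + (v \<bullet> z - v \<bullet> b) \<le> slope_norm \<Lambda> z) \<longleftrightarrow>
      (\<forall>z \<in> carrier_vec p. v \<bullet> z \<le> slope_norm \<Lambda> z) \<and> v \<bullet> b = slope_norm \<Lambda> b"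
  proof (intro iffI)
    assume *: "\<forall>z \<in> carrier_vec p. slope_norm \<Lambda> b + (v \<bullet> z - v \<bullet> b) \<le> slope_norm \<Lambda> z"
    have "slope_norm \<Lambda> b + (t * (v \<bullet> b) - v \<bullet> b) \<le> t * slope_norm \<Lambda> b" if "0 \<le> t" for t
      using *[rule_format, of "t \<cdot>\<^sub>v b"] that v b by (simp add: slope_norm_smult)
    from this[of 0] this[of 2] have "v \<bullet> b = slope_norm \<Lambda> b" by simp
    with * show "(\<forall>z \<in> carrier_vec p. v \<bullet> z \<le> slope_norm \<Lambda> z) \<and> v \<bullet> b = slope_norm \<Lambda> b"
      by auto
  qed auto
  then show ?thesis using sub v slope_dual_ball_iff[OF L v p] by auto
qed (use b in \<open>auto simp: slope_subdifferential_def\<close>)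

section \<open>Optimality condition\<close>

text \<open>
  First-order optimality. Along a segment from b to z the smooth part of the objective is a quadratic
  polynomial in the step length with linear coefficient - (X'(Y - Xb))'(z - b), while the norm is
  convex: for small steps the quadratic term is negligible, so minimality forces the subgradient inequality. Conversely the quadratic term is
  nonnegative.
\<close>

lemma slope_minimizers_iff:
  assumes L: "\<Lambda> \<in> decreasing_pos_vecs p" and X: "X \<in> carrier_mat n p" and Y: "Y \<in> carrier_vec n"
    and b: "b \<in> carrier_vec p"
  shows "b \<in> slope_minimizers X \<Lambda> Y \<longleftrightarrow> X\<^sup>T *\<^sub>v (Y - X *\<^sub>v b) \<in> slope_subdifferential \<Lambda> b"
proof -
  define r where "r = Y - X *\<^sub>v b"
  define g where "g = X\<^sup>T *\<^sub>v r"
  have r: "r \<in> carrier_vec n" and g: "g \<in> carrier_vec p"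
    using X Y b by (auto simp: r_def g_def)
  define q where "q z = (X *\<^sub>v (z - b)) \<bullet> (X *\<^sub>v (z - b))" for z
  have obj: "slope_objective X \<Lambda> Y (b + t \<cdot>\<^sub>v (z - b)) =
      slope_objective X \<Lambda> Y b - t * (g \<bullet> (z - b)) + t\<^sup>2 / 2 * q z
      + (slope_norm \<Lambda> (b + t \<cdot>\<^sub>v (z - b)) - slope_norm \<Lambda> b)" if z: "z \<in> carrier_vec p" for t z
  proof -
    let ?w = "X *\<^sub>v (z - b)"
    have w: "?w \<in> carrier_vec n" using X z b by auto
    have "X *\<^sub>v (b + t \<cdot>\<^sub>v (z - b)) = X *\<^sub>v b + t \<cdot>\<^sub>v ?w"
      using X z b by (simp add: mult_add_distrib_mat_vec[OF X] mult_mat_vec[OF X])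
    then have "Y - X *\<^sub>v (b + t \<cdot>\<^sub>v (z - b)) = r - t \<cdot>\<^sub>v ?w"
      using X Y b z w unfolding r_def by (intro eq_vecI) auto
    moreover have "(r - t \<cdot>\<^sub>v ?w) \<bullet> (r - t \<cdot>\<^sub>v ?w) = r \<bullet> r - 2 * t * (r \<bullet> ?w) + t\<^sup>2 * q z"
      using r w by (simp add: minus_scalar_prod_distrib[of _ n] scalar_prod_minus_distrib[of _ n]
          comm_scalar_prod[of ?w n r] q_def power2_eq_square algebra_simps)
    moreover have "g \<bullet> (z - b) = r \<bullet> ?w"
      using X r z b unfolding g_def by (subst transpose_vec_mult_scalar[OF X]) auto
    ultimately show ?thesis
      by (simp add: slope_objective_def r_def[symmetric] field_simps)
  qed
  have min: "b \<in> slope_minimizers X \<Lambda> Y \<longleftrightarrow>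
      (\<forall>z \<in> carrier_vec p. slope_objective X \<Lambda> Y b \<le> slope_objective X \<Lambda> Y z)"
    using X b by (auto simp: slope_minimizers_def is_arg_min_def not_less)
  have sub: "g \<in> slope_subdifferential \<Lambda> b \<longleftrightarrow>
      (\<forall>z \<in> carrier_vec p. g \<bullet> (z - b) \<le> slope_norm \<Lambda> z - slope_norm \<Lambda> b)"
    using g b by (auto simp: slope_subdifferential_def algebra_simps)
  have "b \<in> slope_minimizers X \<Lambda> Y \<longleftrightarrow> g \<in> slope_subdifferential \<Lambda> b"
    unfolding min sub
  proof (intro iffI ballI)
    fix z :: "real vec" assume opt: "\<forall>z \<in> carrier_vec p. slope_objective X \<Lambda> Y b \<le> slope_objective X \<Lambda> Y z"
      and z: "z \<in> carrier_vec p"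
    let ?d = "slope_norm \<Lambda> z - slope_norm \<Lambda> b - g \<bullet> (z - b)"
    have "- (t / 2 * q z) \<le> ?d" if t: "0 < t" "t < 1" for t
    proof -
      have "slope_objective X \<Lambda> Y b \<le> slope_objective X \<Lambda> Y (b + t \<cdot>\<^sub>v (z - b))"
        using opt b z by simp
      then have "0 \<le> t * (?d + t / 2 * q z)"
        unfolding obj[OF z] using slope_norm_convex[OF L b z, of t] t
        by (simp add: power2_eq_square algebra_simps)
      then show ?thesis using t by (simp add: zero_le_mult_iff)
    qed
    then have "\<forall>\<^sub>F t in at_right 0. - (t / 2 * q z) \<le> ?d"
      by (auto simp: eventually_at_right_field intro!: exI[of _ 1])
    moreover have "((\<lambda>t. - (t / 2 * q z)) \<longlongrightarrow> - (0 / 2 * q z)) (at_right 0)"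
      by (intro tendsto_intros) auto
    ultimately have "- (0 / 2 * q z) \<le> ?d"
      by (intro tendsto_upperbound) auto
    then show "g \<bullet> (z - b) \<le> slope_norm \<Lambda> z - slope_norm \<Lambda> b" by simp
  next
    fix z :: "real vec" assume *: "\<forall>z \<in> carrier_vec p. g \<bullet> (z - b) \<le> slope_norm \<Lambda> z - slope_norm \<Lambda> b"
      and z: "z \<in> carrier_vec p"
    have "b + 1 \<cdot>\<^sub>v (z - b) = z" using b z by (intro eq_vecI) auto
    then show "slope_objective X \<Lambda> Y b \<le> slope_objective X \<Lambda> Y z"
      using obj[OF z, of 1] *[rule_format, OF z] scalar_prod_self_ge_0[of "X *\<^sub>v (z - b)"]
      by (simp add: q_def)
  qed
  then show ?thesis by (simp add: g_def r_def)
qed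

section \<open>The cone of vectors with a given pattern\<close>

lemma abs_le_linf_norm: "i < dim_vec v \<Longrightarrow> \<bar>v $ i\<bar> \<le> linf_norm v"
  by (auto simp: linf_norm_def vec_set_def intro!: Max_ge)

lemma abs_le_nat_linf_norm: "i < dim_vec M \<Longrightarrow> \<bar>M $ i\<bar> \<le> int (nat (linf_norm M))"
  using abs_le_linf_norm[of i M] by linarith

lemma abs_set_abs_sorted: "abs ` set\<^sub>v (abs_sorted v) = abs ` set\<^sub>v v"
proof -
  have "set\<^sub>v (abs_sorted v) = abs ` set\<^sub>v v"
    by (simp add: abs_sorted_def flip: set_list_of_vec) (simp add: list_vec)
  then show ?thesis by (simp add: image_image)
qed

lemma linf_norm_abs_sorted: "linf_norm (abs_sorted v) = linf_norm v"
  by (simp add: linf_norm_def abs_set_abs_sorted)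

lemma pattern_mat_carrier: "pattern_mat M \<in> carrier_mat (dim_vec M) (nat (linf_norm M))"
  by (simp add: pattern_mat_def Let_def)

lemma pattern_mat_mult_index:
  assumes i: "i < dim_vec M" and s: "s \<in> carrier_vec (nat (linf_norm M))"
  shows "(pattern_mat M *\<^sub>v s) $ i =
    real_of_int (sgn (M $ i)) * s $ (nat (linf_norm M) - nat \<bar>M $ i\<bar>)"
proof -
  define k where "k = nat (linf_norm M)"
  have k: "\<bar>M $ i\<bar> \<le> int k" using abs_le_nat_linf_norm[OF i] by (simp add: k_def)
  have "(pattern_mat M *\<^sub>v s) $ i =
      (\<Sum>j<k. (if \<bar>M $ i\<bar> = int k - int j then real_of_int (sgn (M $ i)) else 0) * s $ j)"
    using i s by (simp add: pattern_mat_def Let_def scalar_prod_def atLeast0LessThan k_def)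
  also have "\<dots> = real_of_int (sgn (M $ i)) * s $ (k - nat \<bar>M $ i\<bar>)"
  proof (cases "M $ i = 0")
    case False
    have "(\<Sum>j<k. (if \<bar>M $ i\<bar> = int k - int j then real_of_int (sgn (M $ i)) else 0) * s $ j)
        = (\<Sum>j<k. if j = k - nat \<bar>M $ i\<bar> then real_of_int (sgn (M $ i)) * s $ j else 0)"
      using False k by (intro sum.cong) auto
    then show ?thesis using False k by simp
  qed simp
  finally show ?thesis by (simp add: k_def)
qed

text \<open>
  The absolute value that pattern_mat M * s takes where the pattern has absolute value m. Columns
  are numbered from 0 and the level k comes first, hence the index k - m.
\<close>

definition level_value :: "nat \<Rightarrow> real vec \<Rightarrow> int \<Rightarrow> real" where
  "level_value k s m = (if m = 0 then 0 else s $ (k - nat m))"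

lemma level_value_strict_mono:
  assumes "s \<in> decreasing_pos_vecs k"
  shows "strict_mono_on {0..int k} (level_value k s)"
proof (rule strict_mono_onI)
  fix a b assume "a \<in> {0..int k}" "b \<in> {0..int k}" "a < b"
  then show "level_value k s a < level_value k s b"
    using decreasing_pos_vecsD(2,3)[OF assms] by (auto simp: level_value_def)
qed

lemma level_value_pos:
  assumes "s \<in> decreasing_pos_vecs k" "0 < m" "m \<le> int k"
  shows "0 < level_value k s m"
  using decreasing_pos_vecsD(2)[OF assms(1)] assms(2,3) by (auto simp: level_value_def)

lemma pattern_mat_mult_level:
  assumes "i < dim_vec M" "s \<in> decreasing_pos_vecs (nat (linf_norm M))"
  shows "(pattern_mat M *\<^sub>v s) $ i =
      real_of_int (sgn (M $ i)) * level_value (nat (linf_norm M)) s \<bar>M $ i\<bar>"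
    and "\<bar>(pattern_mat M *\<^sub>v s) $ i\<bar> = level_value (nat (linf_norm M)) s \<bar>M $ i\<bar>"
proof -
  show eq: "(pattern_mat M *\<^sub>v s) $ i =
      real_of_int (sgn (M $ i)) * level_value (nat (linf_norm M)) s \<bar>M $ i\<bar>"
    using pattern_mat_mult_index[OF assms(1) decreasing_pos_vecsD(1)[OF assms(2)]]
    by (simp add: level_value_def)
  have "0 \<le> level_value (nat (linf_norm M)) s \<bar>M $ i\<bar>"
  proof (cases "M $ i = 0")
    case False
    then show ?thesis
      using level_value_pos[OF assms(2) _ abs_le_nat_linf_norm[OF assms(1)]] by (simp add: less_imp_le)
  qed (simp add: level_value_def)
  then show "\<bar>(pattern_mat M *\<^sub>v s) $ i\<bar> = level_value (nat (linf_norm M)) s \<bar>M $ i\<bar>"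
    unfolding eq by (cases "M $ i = 0") (auto simp: abs_mult level_value_def sgn_if)
qed

text \<open>
  For s in the cone, the absolute values of the entries of U_M s arise from those of M by a
  nondecreasing map, so sorting them gives the same map applied to the sorted pattern.
\<close>

lemma abs_sorted_pattern_mat_mult:
  assumes s: "s \<in> decreasing_pos_vecs (nat (linf_norm M))"
  shows "abs_sorted (pattern_mat M *\<^sub>v s) = pattern_mat (abs_sorted M) *\<^sub>v s"
proof -
  let ?k = "nat (linf_norm M)"
  have "mono_on (abs ` set\<^sub>v M) (level_value ?k s)"
  proof (rule mono_on_subset[OF strict_mono_on_imp_mono_on[OF level_value_strict_mono[OF s]]])
    show "abs ` set\<^sub>v M \<subseteq> {0..int ?k}"
      using abs_le_linf_norm[of _ M] by (force simp: vec_set_def)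
  qed
  then have "abs_sorted (pattern_mat M *\<^sub>v s) = map_vec (level_value ?k s) (abs_sorted M)"
    using pattern_mat_mult_level(2)[OF _ s] pattern_mat_carrier[of M]
    by (intro abs_sorted_mono_image) auto
  also have "\<dots> = pattern_mat (abs_sorted M) *\<^sub>v s"
  proof (rule eq_vecI)
    fix i assume "i < dim_vec (pattern_mat (abs_sorted M) *\<^sub>v s)"
    then have i: "i < dim_vec M" using pattern_mat_carrier[of "abs_sorted M"] by simp
    have "(pattern_mat (abs_sorted M) *\<^sub>v s) $ i =
        real_of_int (sgn (abs_sorted M $ i)) * level_value ?k s \<bar>abs_sorted M $ i\<bar>"
      using pattern_mat_mult_level(1)[of i "abs_sorted M" s] i s by (simp add: linf_norm_abs_sorted)
    then show "map_vec (level_value ?k s) (abs_sorted M) $ i = (pattern_mat (abs_sorted M) *\<^sub>v s) $ i"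
      using abs_sorted_nonneg[OF i] i
      by (cases "abs_sorted M $ i = 0") (auto simp: level_value_def)
  qed (use pattern_mat_carrier[of "abs_sorted M"] in simp)
  finally show ?thesis .
qed

lemma clustered_penalty_carrier:
  "clustered_penalty \<Lambda> M \<in> carrier_vec (nat (linf_norm M))"
  using pattern_mat_carrier[of "abs_sorted M"]
  by (auto simp: clustered_penalty_def linf_norm_abs_sorted intro!: carrier_vecI)

text \<open>
  All vectors of the cone are sorted to a linear image of s by one and the same matrix, so the
  sorted norm is linear there; its gradient is the transpose of that matrix applied to \<Lambda>.
\<close>

lemma slope_norm_pattern_mat_mult:
  assumes L: "\<Lambda> \<in> carrier_vec (dim_vec M)" and s: "s \<in> decreasing_pos_vecs (nat (linf_norm M))"
  shows "slope_norm \<Lambda> (pattern_mat M *\<^sub>v s) = clustered_penalty \<Lambda> M \<bullet> s"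
proof -
  let ?U = "pattern_mat (abs_sorted M)"
  have U: "?U \<in> carrier_mat (dim_vec M) (nat (linf_norm M))"
    using pattern_mat_carrier[of "abs_sorted M"] by (simp add: linf_norm_abs_sorted)
  have "slope_norm \<Lambda> (pattern_mat M *\<^sub>v s) = \<Lambda> \<bullet> (?U *\<^sub>v s)"
    using U pattern_mat_carrier[of M]
    by (simp add: slope_norm_def abs_sorted_pattern_mat_mult[OF s] scalar_prod_def atLeast0LessThan
        del: index_mult_mat_vec)
  also have "\<dots> = (?U\<^sup>T *\<^sub>v \<Lambda>) \<bullet> s"
    by (rule transpose_vec_mult_scalar[OF U decreasing_pos_vecsD(1)[OF s] L, symmetric])
  finally show ?thesis by (simp add: clustered_penalty_def)
qed

lemma eventually_decreasing_pos_vecs: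
  assumes s: "s \<in> decreasing_pos_vecs k" and d: "d \<in> carrier_vec k"
  shows "\<forall>\<^sub>F t in at_right 0. s - t \<cdot>\<^sub>v d \<in> decreasing_pos_vecs k"
proof -
  have lim: "((\<lambda>t. s $ i - t * d $ i) \<longlongrightarrow> s $ i) (at_right 0)" for i
    by (rule tendsto_eq_intros refl | simp)+
  have "\<forall>\<^sub>F t in at_right 0. \<forall>i\<in>{..<k}. 0 < s $ i - t * d $ i"
    using decreasing_pos_vecsD(2)[OF s]
    by (intro eventually_ball_finite ballI order_tendstoD(1)[OF lim]) auto
  moreover have "\<forall>\<^sub>F t in at_right 0. \<forall>i\<in>{..<k}. \<forall>j\<in>{..<k}. i < j \<longrightarrow>
      s $ j - t * d $ j < s $ i - t * d $ i"
  proof (intro eventually_ball_finite ballI)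
    fix i j assume "i \<in> {..<k}" "j \<in> {..<k}"
    then show "\<forall>\<^sub>F t in at_right 0. i < j \<longrightarrow> s $ j - t * d $ j < s $ i - t * d $ i"
      using decreasing_pos_vecsD(3)[OF s, of i j]
        order_tendstoD(1)[OF tendsto_diff[OF lim[of i] lim[of j]], of 0]
      by (cases "i < j") (auto elim: eventually_mono)
  qed auto
  ultimately show ?thesis
  proof eventually_elim
    case (elim t)
    then show ?case
      using decreasing_pos_vecsD(1)[OF s] d by (auto simp: decreasing_pos_vecs_def)
  qed
qed

text \<open>
  The subdifferential is the same at all vectors of one pattern. If v lies in the dual ball, then
  s \<mapsto> (\<Lambda>~ - U'v)'s is nonnegative on the cone of admissible s, where the norm is linear with gradient
  \<Lambda>~. A subgradient at U s makes this linear functional vanish at s. As the cone is open, a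
  small step from s against the gradient of the functional stays in the cone, where the functional
  cannot become negative; so the functional is 0.
\<close>

lemma slope_subdifferential_pattern_iff:
  assumes L: "\<Lambda> \<in> decreasing_pos_vecs p" and p: "0 < p" and M: "M \<in> carrier_vec p"
    and s: "s \<in> decreasing_pos_vecs (nat (linf_norm M))"
  shows "v \<in> slope_subdifferential \<Lambda> (pattern_mat M *\<^sub>v s) \<longleftrightarrow>
    v \<in> carrier_vec p \<and> slope_dual_norm \<Lambda> v \<le> 1 \<and>
    (pattern_mat M)\<^sup>T *\<^sub>v v = clustered_penalty \<Lambda> M"
proof -
  define k where "k = nat (linf_norm M)"
  define U where "U = pattern_mat M"
  define l where "l = clustered_penalty \<Lambda> M"
  have U: "U \<in> carrier_mat p k" using pattern_mat_carrier[of M] M by (simp add: U_def k_def)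
  have l: "l \<in> carrier_vec k" by (simp add: l_def k_def clustered_penalty_carrier)
  have norm: "slope_norm \<Lambda> (U *\<^sub>v t) = l \<bullet> t" if "t \<in> decreasing_pos_vecs k" for t
    using slope_norm_pattern_mat_mult[of \<Lambda> M t] that decreasing_pos_vecsD(1)[OF L] M
    by (simp add: U_def l_def k_def)
  have s': "s \<in> decreasing_pos_vecs k" "s \<in> carrier_vec k"
    using s decreasing_pos_vecsD(1) by (auto simp: k_def)
  have adj: "v \<bullet> (U *\<^sub>v t) = (U\<^sup>T *\<^sub>v v) \<bullet> t" if "t \<in> carrier_vec k" "v \<in> carrier_vec p" for t
    using transpose_vec_mult_scalar[OF U that] by simp
  have "U\<^sup>T *\<^sub>v v = l"
    if v: "v \<in> carrier_vec p" and dual: "slope_dual_norm \<Lambda> v \<le> 1"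
      and eq: "v \<bullet> (U *\<^sub>v s) = slope_norm \<Lambda> (U *\<^sub>v s)"
  proof -
    define d where "d = l - U\<^sup>T *\<^sub>v v"
    have d: "d \<in> carrier_vec k" using l U v by (auto simp: d_def)
    have Uv: "U\<^sup>T *\<^sub>v v \<in> carrier_vec k" using U v by auto
    have ds: "d \<bullet> s = 0"
      using eq norm[OF s'(1)] adj[OF s'(2) v] l Uv s'(2)
      by (simp add: d_def minus_scalar_prod_distrib[of _ k])
    have "\<forall>\<^sub>F t in at_right 0. 0 < t \<and> s - t \<cdot>\<^sub>v d \<in> decreasing_pos_vecs k"
      by (intro eventually_conj eventually_at_right_less eventually_decreasing_pos_vecs s' d)
    then obtain t where t: "0 < t" "s - t \<cdot>\<^sub>v d \<in> decreasing_pos_vecs k"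
      using eventually_happens'[OF trivial_limit_at_right_real] by blast
    have st: "s - t \<cdot>\<^sub>v d \<in> carrier_vec k" using t decreasing_pos_vecsD(1) by blast
    have "v \<bullet> (U *\<^sub>v (s - t \<cdot>\<^sub>v d)) \<le> slope_norm \<Lambda> (U *\<^sub>v (s - t \<cdot>\<^sub>v d))"
      using dual slope_dual_ball_iff[OF L v p] U st by auto
    then have "0 \<le> d \<bullet> (s - t \<cdot>\<^sub>v d)"
      unfolding norm[OF t(2)] adj[OF st v] d_def[symmetric]
      using l Uv st by (simp add: d_def minus_scalar_prod_distrib[of l k])
    also have "\<dots> = - (t * (d \<bullet> d))"
      using d s' ds by (simp add: scalar_prod_minus_distrib[of _ k])
    finally have "d \<bullet> d = 0"
      using t(1) scalar_prod_self_ge_0[of d] by (simp add: mult_le_0_iff)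
    then have "d = 0\<^sub>v k" by (rule scalar_prod_self_eq_0[OF d])
    then show ?thesis using vec_minus_eq_0_imp_eq[OF l Uv] by (simp add: d_def)
  qed
  moreover have "v \<bullet> (U *\<^sub>v s) = slope_norm \<Lambda> (U *\<^sub>v s)"
    if "v \<in> carrier_vec p" "U\<^sup>T *\<^sub>v v = l"
    using that norm[OF s'(1)] adj[OF s'(2)] by simp
  moreover have "U *\<^sub>v s \<in> carrier_vec p" using U s' by simp
  ultimately show ?thesis
    using slope_subdifferential_iff[OF L p, of "U *\<^sub>v s" v] unfolding U_def l_def by blast
qed

text \<open>
  Through this lemma the description of the subdifferential on the cone also covers the
  subgradient condition at the pattern itself.
\<close>

lemma pattern_as_pattern_mat_mult:
  "\<exists>s \<in> decreasing_pos_vecs (nat (linf_norm M)). map_vec real_of_int M = pattern_mat M *\<^sub>v s"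
proof -
  define k where "k = nat (linf_norm M)"
  define s where "s = vec k (\<lambda>j. real (k - j))"
  have s: "s \<in> decreasing_pos_vecs k" by (auto simp: s_def decreasing_pos_vecs_def)
  have "map_vec real_of_int M = pattern_mat M *\<^sub>v s"
  proof (rule eq_vecI)
    fix i assume "i < dim_vec (pattern_mat M *\<^sub>v s)"
    then have i: "i < dim_vec M" using pattern_mat_carrier[of M] by simp
    have "level_value k s \<bar>M $ i\<bar> = \<bar>real_of_int (M $ i)\<bar>"
      using abs_le_linf_norm[OF i] by (auto simp: level_value_def s_def k_def)
    then show "map_vec real_of_int M $ i = (pattern_mat M *\<^sub>v s) $ i"
      using pattern_mat_mult_level(1)[OF i s[unfolded k_def]] i
      by (simp add: k_def sgn_if)
  qed (use pattern_mat_carrier[of M] in simp)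
  then show ?thesis using s by (auto simp: k_def)
qed

lemma card_image_eq_if_same_fibres:
  assumes "\<And>x y. x \<in> J \<Longrightarrow> y \<in> J \<Longrightarrow> f x = f y \<longleftrightarrow> g x = g y"
  shows "card (f ` J) = card (g ` J)"
proof (rule bij_betw_same_card)
  have inv: "inv_into J f y \<in> J" "f (inv_into J f y) = y" if "y \<in> f ` J" for y
    using that by (auto intro: inv_into_into f_inv_into_f)
  show "bij_betw (\<lambda>y. g (inv_into J f y)) (f ` J) (g ` J)"
  proof (rule bij_betw_imageI)
    show "inj_on (\<lambda>y. g (inv_into J f y)) (f ` J)"
    proof (rule inj_onI)
      fix x y assume "x \<in> f ` J" "y \<in> f ` J" "g (inv_into J f x) = g (inv_into J f y)"
      then show "x = y" using assms[OF inv(1) inv(1), of x y] inv(2) by simp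
    qed
    have "g (inv_into J f (f x)) = g x" if "x \<in> J" for x
      using assms[OF inv(1), of "f x" x] inv(2)[of "f x"] that by simp
    then show "(\<lambda>y. g (inv_into J f y)) ` f ` J = g ` J" by force
  qed
qed

text \<open>
  A pattern depends only on the signs and on the order of the absolute values: the ranks count
  classes of indices with equal absolute value.
\<close>

lemma patt_cong:
  assumes dim: "dim_vec b = dim_vec c"
    and sgn: "\<And>i. i < dim_vec c \<Longrightarrow> sgn (b $ i) = sgn (c $ i)"
    and ord: "\<And>i j. i < dim_vec c \<Longrightarrow> j < dim_vec c \<Longrightarrow>
      \<bar>b $ i\<bar> \<le> \<bar>b $ j\<bar> \<longleftrightarrow> \<bar>c $ i\<bar> \<le> \<bar>c $ j\<bar>"
  shows "patt b = patt c"
proof -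
  have sign: "b $ i = 0 \<longleftrightarrow> c $ i = 0" "b $ i < 0 \<longleftrightarrow> c $ i < 0" if "i < dim_vec c" for i
    using sgn[OF that] by (auto simp: sgn_if split: if_splits)
  have rank: "abs_rank b i = abs_rank c i" if i: "i < dim_vec c" for i
  proof -
    let ?J = "\<lambda>v. {j. j < dim_vec c \<and> v $ j \<noteq> 0 \<and> \<bar>v $ j\<bar> \<le> \<bar>v $ i :: real\<bar>}"
    have J: "?J b = ?J c" using sign ord i by auto
    have "abs_rank v i = card ((\<lambda>j. \<bar>v $ j\<bar>) ` ?J v)" if "dim_vec v = dim_vec c" for v
      unfolding abs_rank_def vec_set_def that by (intro arg_cong[of _ _ card]) auto
    moreover have "card ((\<lambda>j. \<bar>b $ j\<bar>) ` ?J c) = card ((\<lambda>j. \<bar>c $ j\<bar>) ` ?J c)"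
    proof (rule card_image_eq_if_same_fibres)
      fix x y assume "x \<in> ?J c" "y \<in> ?J c"
      then show "\<bar>b $ x\<bar> = \<bar>b $ y\<bar> \<longleftrightarrow> \<bar>c $ x\<bar> = \<bar>c $ y\<bar>"
        using ord[of x y] ord[of y x] by (auto simp: order.eq_iff[of "\<bar>_\<bar>"])
    qed
    ultimately show ?thesis using dim J by simp
  qed
  show ?thesis
    unfolding patt_def dim using sign rank by (intro eq_vecI) auto
qed

lemma patt_pattern_mat_mult_cong:
  assumes s: "s \<in> decreasing_pos_vecs (nat (linf_norm M))"
    and t: "t \<in> decreasing_pos_vecs (nat (linf_norm M))"
  shows "patt (pattern_mat M *\<^sub>v s) = patt (pattern_mat M *\<^sub>v t)"
proof (rule patt_cong)
  let ?k = "nat (linf_norm M)"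
  have dim: "dim_vec (pattern_mat M *\<^sub>v t) = dim_vec M"
    using pattern_mat_carrier[of M] by simp
  have range: "\<bar>M $ i\<bar> \<in> {0..int ?k}" if "i < dim_vec M" for i
    using abs_le_nat_linf_norm[OF that] by simp
  show "\<bar>(pattern_mat M *\<^sub>v s) $ i\<bar> \<le> \<bar>(pattern_mat M *\<^sub>v s) $ j\<bar> \<longleftrightarrow>
      \<bar>(pattern_mat M *\<^sub>v t) $ i\<bar> \<le> \<bar>(pattern_mat M *\<^sub>v t) $ j\<bar>"
    if "i < dim_vec (pattern_mat M *\<^sub>v t)" "j < dim_vec (pattern_mat M *\<^sub>v t)" for i j
    using that range strict_mono_on_less_eq[OF level_value_strict_mono[OF s]]
      strict_mono_on_less_eq[OF level_value_strict_mono[OF t]]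
    unfolding dim by (simp add: pattern_mat_mult_level(2) s t)
  show "sgn ((pattern_mat M *\<^sub>v s) $ i) = sgn ((pattern_mat M *\<^sub>v t) $ i)"
    if "i < dim_vec (pattern_mat M *\<^sub>v t)" for i
    using that level_value_pos[OF s, of "\<bar>M $ i\<bar>"] level_value_pos[OF t, of "\<bar>M $ i\<bar>"] range[of i]
    unfolding dim by (cases "M $ i = 0") (simp_all add: pattern_mat_mult_level(1) s t sgn_mult)
qed simp

text \<open>
  The rank function numbers the distinct nonzero absolute values of b increasingly by 1, ..., k, so
  s lists these values in decreasing order, which is the inverse of the rank function read backwards.
\<close>

lemma patt_decomposition:
  assumes M: "patt b = M" and nz: "M \<noteq> 0\<^sub>v (dim_vec b)"
  shows "\<exists>s \<in> decreasing_pos_vecs (nat (linf_norm M)). b = pattern_mat M *\<^sub>v s"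
proof -
  define A where "A = abs ` set\<^sub>v b - {0}"
  define r where "r x = card {a \<in> A. a \<le> x}" for x
  have fin: "finite A" by (simp add: A_def vec_set_def)
  have rank: "abs_rank b i = r \<bar>b $ i\<bar>" for i
    unfolding abs_rank_def r_def A_def by (rule arg_cong[of _ _ card]) auto
  have strict: "r x < r y" if "x < y" "y \<in> A" for x y
    unfolding r_def
  proof (rule psubset_card_mono)
    have "y \<in> {a \<in> A. a \<le> y}" "y \<notin> {a \<in> A. a \<le> x}" using that by auto
    moreover have "{a \<in> A. a \<le> x} \<subseteq> {a \<in> A. a \<le> y}" using that by auto
    ultimately show "{a \<in> A. a \<le> x} \<subset> {a \<in> A. a \<le> y}" by blast
  qed (use fin in simp)
  have strict_iff: "r x < r y \<longleftrightarrow> x < y" if "x \<in> A" "y \<in> A" for x y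
    using strict[of x y] strict[of y x] that by (cases x y rule: linorder_cases) auto
  have bij: "bij_betw r A {1..card A}"
  proof (rule bij_betw_imageI)
    show inj: "inj_on r A" 
    proof (rule inj_onI)
      fix x y assume "x \<in> A" "y \<in> A" "r x = r y"
      then show "x = y"
        using strict_iff[of x y] strict_iff[of y x] by (cases x y rule: linorder_cases) auto
    qed
    have "r x \<in> {1..card A}" if "x \<in> A" for x
    proof -
      have "x \<in> {a \<in> A. a \<le> x}" using that by simp
      then have "0 < r x" unfolding r_def using fin by (subst card_gt_0_iff) auto
      moreover have "r x \<le> card A" unfolding r_def using fin by (intro card_mono) auto
      ultimately show ?thesis by simp
    qed
    then show "r ` A = {1..card A}"
      using card_image[OF inj] by (intro card_subset_eq) auto
  qed
  have Mi: "M $ i = (if b $ i < 0 then -1 else if b $ i = 0 then 0 else 1) * int (r \<bar>b $ i\<bar>)"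
    if "i < dim_vec b" for i
    using that M rank by (auto simp: patt_def)
  have dimM: "dim_vec M = dim_vec b" using M by (auto simp: patt_def)
  have inA: "\<bar>b $ i\<bar> \<in> A" if "i < dim_vec b" "b $ i \<noteq> 0" for i
    using that by (auto simp: A_def vec_set_def)
  have absM: "\<bar>M $ i\<bar> = (if b $ i = 0 then 0 else int (r \<bar>b $ i\<bar>))" if "i < dim_vec b" for i
    using Mi[OF that] by auto
  have k: "linf_norm M = int (card A)"
  proof -
    have "A \<noteq> {}"
    proof
      assume "A = {}"
      then have "M $ i = 0" if "i < dim_vec b" for i
        using Mi[OF that] inA[OF that] by auto
      then show False using nz dimM by (auto intro!: eq_vecI)
    qed
    then have "card A \<in> r ` A" using bij fin
      by (auto simp: bij_betw_def Suc_le_eq card_gt_0_iff)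
    then obtain x where x: "x \<in> A" "r x = card A" by auto
    then obtain i where i: "i < dim_vec b" "\<bar>b $ i\<bar> = x" by (auto simp: A_def vec_set_def)
    then have "\<bar>M $ i\<bar> = int (card A)" using absM[of i] x by (auto simp: A_def)
    moreover have "\<bar>M $ i\<bar> \<le> int (card A)" if "i < dim_vec b" for i
      using absM[OF that] inA[OF that] bij by (auto simp: bij_betw_def)
    ultimately show ?thesis
      using i dimM unfolding linf_norm_def vec_set_def by (intro Max_eqI) (auto intro!: image_eqI[of _ _ "M $ i"])
  qed
  define s where "s = vec (card A) (\<lambda>j. inv_into A r (card A - j))"
  have inv: "inv_into A r m \<in> A" "r (inv_into A r m) = m" if "m \<in> {1..card A}" for m
    using bij that by (auto simp: bij_betw_def intro: inv_into_into f_inv_into_f)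
  have s: "s \<in> decreasing_pos_vecs (card A)"
    unfolding decreasing_pos_vecs_def
  proof (intro CollectI conjI allI impI)
    fix i assume i: "i < card A"
    have "inv_into A r (card A - i) \<in> A" using i by (intro inv) auto
    then show "0 < s $ i" using i by (auto simp: s_def A_def)
  next
    fix i j assume ij: "i < card A" "j < card A" "i < j"
    then have "card A - i \<in> {1..card A}" "card A - j \<in> {1..card A}" "card A - j < card A - i"
      by auto
    with ij show "s $ j < s $ i"
      using strict_iff[of "inv_into A r (card A - j)" "inv_into A r (card A - i)"] inv
      by (simp add: s_def)
  qed (simp add: s_def)
  have "b = pattern_mat M *\<^sub>v s"
  proof (rule eq_vecI)
    show "dim_vec b = dim_vec (pattern_mat M *\<^sub>v s)"
      using pattern_mat_carrier[of M] dimM by simp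
    then have dim: "dim_vec (pattern_mat M *\<^sub>v s) = dim_vec b" by simp
    fix i assume "i < dim_vec (pattern_mat M *\<^sub>v s)"
    then have i: "i < dim_vec b" by (simp only: dim)
    have eq: "(pattern_mat M *\<^sub>v s) $ i =
        real_of_int (sgn (M $ i)) * level_value (card A) s \<bar>M $ i\<bar>"
      using pattern_mat_mult_level(1)[of i M s] i dimM s k by simp
    show "b $ i = (pattern_mat M *\<^sub>v s) $ i"
    proof (cases "b $ i = 0")
      case True
      then show ?thesis using eq absM[OF i] by simp
    next
      case False
      have r: "r \<bar>b $ i\<bar> \<in> {1..card A}" using bij inA[OF i False] by (auto simp: bij_betw_def)
      have "level_value (card A) s \<bar>M $ i\<bar> = inv_into A r (r \<bar>b $ i\<bar>)"
        using absM[OF i] False r by (auto simp: level_value_def s_def)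
      also have "\<dots> = \<bar>b $ i\<bar>"
        using bij inA[OF i False] by (auto simp: bij_betw_def)
      finally have "(pattern_mat M *\<^sub>v s) $ i = real_of_int (sgn (M $ i)) * \<bar>b $ i\<bar>"
        using eq by simp
      moreover have "real_of_int (sgn (M $ i)) = sgn (b $ i)"
        using Mi[OF i] r False by (auto simp: sgn_if)
      ultimately show ?thesis by (simp add: sgn_mult_abs)
    qed
  qed
  then show ?thesis using s k by auto
qed

section \<open>Scaling the penalty\<close>

lemma dual_certificate_smult:
  assumes X: "X \<in> carrier_mat n p" and M: "M \<in> carrier_vec p" and L: "\<Lambda> \<in> carrier_vec p"
  shows "dual_certificate X (t \<cdot>\<^sub>v \<Lambda>) M = t \<cdot>\<^sub>v dual_certificate X \<Lambda> M"
proof -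
  let ?k = "nat (linf_norm M)"
  have A: "(clustered_mat X M)\<^sup>T \<in> carrier_mat ?k n"
    using X M pattern_mat_carrier[of M] by (auto simp: clustered_mat_def)
  have P: "pseudo_inverse (clustered_mat X M)\<^sup>T \<in> carrier_mat n ?k"
    using is_pseudo_inverse_pseudo_inverse[of "(clustered_mat X M)\<^sup>T"] A
    by (auto simp: is_pseudo_inverse_def)
  have U: "(pattern_mat (abs_sorted M))\<^sup>T \<in> carrier_mat ?k p"
    using pattern_mat_carrier[of "abs_sorted M"] M by (simp add: linf_norm_abs_sorted)
  have "clustered_penalty (t \<cdot>\<^sub>v \<Lambda>) M = t \<cdot>\<^sub>v clustered_penalty \<Lambda> M"
    unfolding clustered_penalty_def by (rule mult_mat_vec[OF U L])
  then show ?thesis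
    using mult_mat_vec[OF P clustered_penalty_carrier] mult_mat_vec[of "X\<^sup>T" p n] X P
      clustered_penalty_carrier[of \<Lambda> M]
    by (simp add: dual_certificate_def)
qed

lemma smult_slope_subdifferential:
  assumes L: "\<Lambda> \<in> carrier_vec (dim_vec b)" and t: "0 \<le> t"
    and v: "v \<in> slope_subdifferential \<Lambda> b"
  shows "t \<cdot>\<^sub>v v \<in> slope_subdifferential (t \<cdot>\<^sub>v \<Lambda>) b"
  unfolding slope_subdifferential_def
proof (intro CollectI conjI ballI)
  show "t \<cdot>\<^sub>v v \<in> carrier_vec (dim_vec b)" using v by (simp add: slope_subdifferential_def)
  fix z :: "real vec" assume z: "z \<in> carrier_vec (dim_vec b)"
  have "t * (slope_norm \<Lambda> b + v \<bullet> (z - b)) \<le> t * slope_norm \<Lambda> z"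
    using v z t by (intro mult_left_mono) (auto simp: slope_subdifferential_def)
  then show "slope_norm (t \<cdot>\<^sub>v \<Lambda>) b + (t \<cdot>\<^sub>v v) \<bullet> (z - b) \<le> slope_norm (t \<cdot>\<^sub>v \<Lambda>) z"
    using L z v by (simp add: slope_norm_smult_penalty slope_subdifferential_def algebra_simps)
qed

lemma smult_decreasing_pos_vecs:
  "\<Lambda> \<in> decreasing_pos_vecs p \<Longrightarrow> 0 < t \<Longrightarrow> t \<cdot>\<^sub>v \<Lambda> \<in> decreasing_pos_vecs p"
  by (auto simp: decreasing_pos_vecs_def)

section \<open>Recovery of the pattern from noiseless data\<close>

theorem corollary3p2:
  fixes n p :: nat and X :: "real mat" and \<beta> :: "real vec" and M :: "int vec"
  assumes "X \<in> carrier_mat n p" and "\<beta> \<in> carrier_vec p"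
    and "patt \<beta> = M" and "M \<noteq> 0\<^sub>v p"
  shows
    "((\<exists>\<Lambda> \<in> decreasing_pos_vecs p. \<exists>\<beta>hat \<in> slope_minimizers X \<Lambda> (X *\<^sub>v \<beta>). patt \<beta>hat = patt \<beta>)
      \<longleftrightarrow>
      (\<forall>l > 0. \<exists>\<Lambda> \<in> decreasing_pos_vecs p. \<Lambda> $ 0 < l \<and>
         (\<exists>\<beta>hat \<in> slope_minimizers X \<Lambda> (X *\<^sub>v \<beta>). patt \<beta>hat = patt \<beta>)))
     \<and>
     ((\<forall>l > 0. \<exists>\<Lambda> \<in> decreasing_pos_vecs p. \<Lambda> $ 0 < l \<and>
         (\<exists>\<beta>hat \<in> slope_minimizers X \<Lambda> (X *\<^sub>v \<beta>). patt \<beta>hat = patt \<beta>))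
      \<longleftrightarrow>
      (\<exists>\<Lambda> \<in> decreasing_pos_vecs p.
         dual_certificate X \<Lambda> M \<in> slope_subdifferential \<Lambda> (map_vec real_of_int M)))
     \<and>
     ((\<exists>\<Lambda> \<in> decreasing_pos_vecs p.
         dual_certificate X \<Lambda> M \<in> slope_subdifferential \<Lambda> (map_vec real_of_int M))
      \<longleftrightarrow>
      (\<forall>l > 0. \<exists>\<Lambda> \<in> decreasing_pos_vecs p. \<Lambda> $ 0 < l \<and>
         dual_certificate X \<Lambda> M \<in> slope_subdifferential \<Lambda> (map_vec real_of_int M)))
     \<and>
     (\<forall>\<Lambda> \<in> decreasing_pos_vecs p.
        dual_certificate X \<Lambda> M \<in> slope_subdifferential \<Lambda> (map_vec real_of_int M)
        \<longleftrightarrow>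
        slope_dual_norm \<Lambda> (dual_certificate X \<Lambda> M) \<le> 1 \<and>
        clustered_penalty \<Lambda> M \<in> col_space (transpose_mat (clustered_mat X M)))"
proof -
  note X = assms(1) and patt = assms(3)
  define k where "k = nat (linf_norm M)"
  define U where "U = pattern_mat M"
  define A where "A = (clustered_mat X M)\<^sup>T"
  define P where "P = pseudo_inverse A"
  define l where "l \<Lambda> = clustered_penalty \<Lambda> M" for \<Lambda>
  have M: "M \<in> carrier_vec p" using assms(2,3) by (auto simp: patt_def)
  have p: "0 < p" using M assms(4) by (cases p) auto
  have U: "U \<in> carrier_mat p k" using pattern_mat_carrier[of M] M by (simp add: U_def k_def)
  have At: "A\<^sup>T = X * U" by (simp add: A_def U_def clustered_mat_def)
  have A: "A \<in> carrier_mat k n" using X U by (simp add: A_def clustered_mat_def flip: U_def)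
  have pinv: "is_pseudo_inverse A P"
    unfolding P_def by (rule is_pseudo_inverse_pseudo_inverse)
  then have P: "P \<in> carrier_mat n k" using A by (auto simp: is_pseudo_inverse_def)
  have l: "l \<Lambda> \<in> carrier_vec k" for \<Lambda> by (simp add: l_def k_def clustered_penalty_carrier)
  have cert: "dual_certificate X \<Lambda> M = X\<^sup>T *\<^sub>v (P *\<^sub>v l \<Lambda>)" for \<Lambda>
    by (simp add: dual_certificate_def P_def A_def l_def)
  have cert_carrier: "dual_certificate X \<Lambda> M \<in> carrier_vec p" for \<Lambda>
    using X P l[of \<Lambda>] by (simp add: cert)
  have Ut_Xt: "U\<^sup>T *\<^sub>v (X\<^sup>T *\<^sub>v w) = A *\<^sub>v w" if "w \<in> carrier_vec n" for w
    using assoc_mult_mat_vec[of "U\<^sup>T" k p "X\<^sup>T" n w] transpose_mult[OF X U] U X that At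
    by (metis transpose_carrier_mat transpose_transpose)
  have XU: "X *\<^sub>v (U *\<^sub>v t) = A\<^sup>T *\<^sub>v t" if "t \<in> carrier_vec k" for t
    using assoc_mult_mat_vec[OF X U that] At by simp
  have subdiff: "v \<in> slope_subdifferential \<Lambda> (U *\<^sub>v t) \<longleftrightarrow>
      v \<in> carrier_vec p \<and> slope_dual_norm \<Lambda> v \<le> 1 \<and> U\<^sup>T *\<^sub>v v = l \<Lambda>"
    if "\<Lambda> \<in> decreasing_pos_vecs p" "t \<in> decreasing_pos_vecs k" for v \<Lambda> t
    using slope_subdifferential_pattern_iff[OF that(1) p M] that(2)
    unfolding U_def l_def k_def by blast
  obtain m where m: "m \<in> decreasing_pos_vecs k" "map_vec real_of_int M = U *\<^sub>v m"
    using pattern_as_pattern_mat_mult[of M] by (auto simp: U_def k_def)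
  obtain s where s: "s \<in> decreasing_pos_vecs k" "\<beta> = U *\<^sub>v s"
    using patt_decomposition[OF patt] assms(2,4) by (auto simp: U_def k_def)
  have sc: "s \<in> carrier_vec k" using s decreasing_pos_vecsD(1) by blast

  have cert_iff: "dual_certificate X \<Lambda> M \<in> slope_subdifferential \<Lambda> (map_vec real_of_int M) \<longleftrightarrow>
      slope_dual_norm \<Lambda> (dual_certificate X \<Lambda> M) \<le> 1 \<and> A *\<^sub>v (P *\<^sub>v l \<Lambda>) = l \<Lambda>"
    if "\<Lambda> \<in> decreasing_pos_vecs p" for \<Lambda>
    unfolding m(2) subdiff[OF that m(1)]
    using Ut_Xt[of "P *\<^sub>v l \<Lambda>"] P l[of \<Lambda>] cert_carrier[of \<Lambda>] by (simp add: cert)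
  have col_iff: "A *\<^sub>v (P *\<^sub>v l \<Lambda>) = l \<Lambda> \<longleftrightarrow> l \<Lambda> \<in> col_space A" for \<Lambda>
  proof -
    have col: "col_space A = {y \<in> carrier_vec k. \<exists>x \<in> carrier_vec n. A *\<^sub>v x = y}"
      using vec_space.col_space_eq[OF A] A by (simp add: col_space_def)
    have "A *\<^sub>v (P *\<^sub>v (A *\<^sub>v x)) = A *\<^sub>v x" if "x \<in> carrier_vec n" for x
    proof -
      have "A *\<^sub>v (P *\<^sub>v (A *\<^sub>v x)) = (A * P * A) *\<^sub>v x"
        using assoc_mult_mat_vec[OF mult_carrier_mat[OF A P] A that]
          assoc_mult_mat_vec[OF A P mult_mat_vec_carrier[OF A that]] by simp
      then show ?thesis using pinv by (simp only: is_pseudo_inverse_def)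
    qed
    then show ?thesis unfolding col using l[of \<Lambda>] P by fastforce
  qed

  \<comment> \<open>The residual of a minimizer with the right pattern is A'(s - t), which lies in the row space of
    A. The optimality condition says that A maps it to the clustered penalty, so the residual is what
    the pseudo-inverse P assigns to the clustered penalty.\<close>
  have certificate_of_minimizer:
    "dual_certificate X \<Lambda> M \<in> slope_subdifferential \<Lambda> (map_vec real_of_int M)"
    if L: "\<Lambda> \<in> decreasing_pos_vecs p" and min: "b \<in> slope_minimizers X \<Lambda> (X *\<^sub>v \<beta>)"
      and pb: "patt b = patt \<beta>" for \<Lambda> b
  proof -
    have b: "b \<in> carrier_vec p"
      using min X by (auto simp: slope_minimizers_def is_arg_min_def)
    obtain t where t: "t \<in> decreasing_pos_vecs k" "b = U *\<^sub>v t"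
      using patt_decomposition[of b M] pb patt b assms(4) by (auto simp: U_def k_def)
    have tc: "t \<in> carrier_vec k" using t decreasing_pos_vecsD(1) by blast
    have res: "X *\<^sub>v \<beta> - X *\<^sub>v b = A\<^sup>T *\<^sub>v (s - t)"
      unfolding s(2) t(2) XU[OF sc] XU[OF tc]
      using mult_minus_distrib_mat_vec[of "A\<^sup>T" n k s t] A sc tc by simp
    have grad: "X\<^sup>T *\<^sub>v (A\<^sup>T *\<^sub>v (s - t)) \<in> slope_subdifferential \<Lambda> (U *\<^sub>v t)"
      unfolding res[symmetric] t(2)[symmetric]
      using min slope_minimizers_iff[OF L X _ b] X assms(2) by simp
    then have "A *\<^sub>v (A\<^sup>T *\<^sub>v (s - t)) = l \<Lambda>"
      using subdiff[OF L t(1)] Ut_Xt[of "A\<^sup>T *\<^sub>v (s - t)"] A sc tc by simp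
    then have "P *\<^sub>v l \<Lambda> = A\<^sup>T *\<^sub>v (s - t)"
      using pseudo_inverse_row_space[OF pinv A, of "s - t"] sc tc by simp
    then show ?thesis
      using grad subdiff[OF L t(1)] subdiff[OF L m(1)] by (simp add: cert m(2))
  qed
  \<comment> \<open>Conversely P maps the clustered penalty to some A'u. Shrinking the cluster values s by a small
    multiple c u stays in the cone and leaves the residual c A'u, whose gradient is c times the
    certificate; this is optimal for the penalty c \<Lambda>.\<close>
  have minimizer_of_certificate:
    "\<forall>\<^sub>F c in at_right 0. \<exists>b \<in> slope_minimizers X (c \<cdot>\<^sub>v \<Lambda>) (X *\<^sub>v \<beta>). patt b = patt \<beta>"
    if L: "\<Lambda> \<in> decreasing_pos_vecs p"
      and C: "dual_certificate X \<Lambda> M \<in> slope_subdifferential \<Lambda> (map_vec real_of_int M)" for \<Lambda>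
  proof -
    obtain u where u: "u \<in> carrier_vec k" "P *\<^sub>v l \<Lambda> = A\<^sup>T *\<^sub>v u"
      using pseudo_inverse_mult_in_row_space[OF pinv A l] by blast
    have "\<forall>\<^sub>F c in at_right 0. 0 < c \<and> s - c \<cdot>\<^sub>v u \<in> decreasing_pos_vecs k"
      by (intro eventually_conj eventually_at_right_less eventually_decreasing_pos_vecs s u)
    then show ?thesis
    proof (rule eventually_mono)
      fix c assume c: "0 < c \<and> s - c \<cdot>\<^sub>v u \<in> decreasing_pos_vecs k"
      define b where "b = U *\<^sub>v (s - c \<cdot>\<^sub>v u)"
      have b: "b \<in> carrier_vec p" using U u sc by (simp add: b_def)
      have Lc: "c \<cdot>\<^sub>v \<Lambda> \<in> decreasing_pos_vecs p"
        using smult_decreasing_pos_vecs[OF L] c by simp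
      have "X *\<^sub>v \<beta> - X *\<^sub>v b = A\<^sup>T *\<^sub>v s - A\<^sup>T *\<^sub>v (s - c \<cdot>\<^sub>v u)"
        using XU[OF sc] XU[of "s - c \<cdot>\<^sub>v u"] sc u by (simp add: s(2) b_def)
      also have "\<dots> = A\<^sup>T *\<^sub>v (s - (s - c \<cdot>\<^sub>v u))"
        using A sc u by (simp add: mult_minus_distrib_mat_vec[of "A\<^sup>T" n k])
      also have "s - (s - c \<cdot>\<^sub>v u) = c \<cdot>\<^sub>v u"
        using sc u by (intro eq_vecI) auto
      also have "A\<^sup>T *\<^sub>v (c \<cdot>\<^sub>v u) = c \<cdot>\<^sub>v (P *\<^sub>v l \<Lambda>)"
        using mult_mat_vec[of "A\<^sup>T" n k u c] A u by simp
      finally have "X\<^sup>T *\<^sub>v (X *\<^sub>v \<beta> - X *\<^sub>v b) = c \<cdot>\<^sub>v dual_certificate X \<Lambda> M"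
        using mult_mat_vec[of "X\<^sup>T" p n "P *\<^sub>v l \<Lambda>" c] X P l[of \<Lambda>] by (simp add: cert)
      moreover have "c \<cdot>\<^sub>v dual_certificate X \<Lambda> M \<in>
          slope_subdifferential (c \<cdot>\<^sub>v \<Lambda>) (map_vec real_of_int M)"
        using smult_slope_subdifferential[OF _ _ C, of c] c M decreasing_pos_vecsD(1)[OF L] by simp
      ultimately have "X\<^sup>T *\<^sub>v (X *\<^sub>v \<beta> - X *\<^sub>v b) \<in> slope_subdifferential (c \<cdot>\<^sub>v \<Lambda>) b"
        using subdiff[OF Lc m(1)] subdiff[OF Lc, of "s - c \<cdot>\<^sub>v u"] c
        by (simp add: m(2) b_def)
      then have "b \<in> slope_minimizers X (c \<cdot>\<^sub>v \<Lambda>) (X *\<^sub>v \<beta>)"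
        using slope_minimizers_iff[OF Lc X _ b] X assms(2) by simp
      moreover have "patt b = patt \<beta>"
        using patt_pattern_mat_mult_cong[of "s - c \<cdot>\<^sub>v u" M s] c s
        by (simp add: b_def U_def k_def)
      ultimately show "\<exists>b \<in> slope_minimizers X (c \<cdot>\<^sub>v \<Lambda>) (X *\<^sub>v \<beta>). patt b = patt \<beta>" by blast
    qed
  qed
  have small: "\<exists>\<Lambda>' \<in> decreasing_pos_vecs p. \<Lambda>' $ 0 < r \<and>
        (\<exists>b \<in> slope_minimizers X \<Lambda>' (X *\<^sub>v \<beta>). patt b = patt \<beta>) \<and>
        dual_certificate X \<Lambda>' M \<in> slope_subdifferential \<Lambda>' (map_vec real_of_int M)"
    if L: "\<Lambda> \<in> decreasing_pos_vecs p"
      and C: "dual_certificate X \<Lambda> M \<in> slope_subdifferential \<Lambda> (map_vec real_of_int M)"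
      and r: "0 < r" for \<Lambda> and r :: real
  proof -
    have "((\<lambda>c. c * \<Lambda> $ 0) \<longlongrightarrow> 0 * \<Lambda> $ 0) (at_right 0)" by (intro tendsto_intros)
    then have "\<forall>\<^sub>F c in at_right 0. c * \<Lambda> $ 0 < r" using r by (intro order_tendstoD(2)) auto
    then have "\<forall>\<^sub>F c in at_right 0. 0 < c \<and> c * \<Lambda> $ 0 < r \<and>
        (\<exists>b \<in> slope_minimizers X (c \<cdot>\<^sub>v \<Lambda>) (X *\<^sub>v \<beta>). patt b = patt \<beta>)"
      by (intro eventually_conj eventually_at_right_less minimizer_of_certificate[OF L C])
    then obtain c where c: "0 < c" "c * \<Lambda> $ 0 < r"
        "\<exists>b \<in> slope_minimizers X (c \<cdot>\<^sub>v \<Lambda>) (X *\<^sub>v \<beta>). patt b = patt \<beta>"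
      using eventually_happens'[OF trivial_limit_at_right_real] by blast
    have Lp: "\<Lambda> \<in> carrier_vec p" using decreasing_pos_vecsD(1)[OF L] .
    have "dual_certificate X (c \<cdot>\<^sub>v \<Lambda>) M \<in> slope_subdifferential (c \<cdot>\<^sub>v \<Lambda>) (map_vec real_of_int M)"
      unfolding dual_certificate_smult[OF X M Lp]
      using c Lp M by (intro smult_slope_subdifferential C) auto
    moreover have "(c \<cdot>\<^sub>v \<Lambda>) $ 0 < r" using Lp p c by simp
    ultimately show ?thesis using c smult_decreasing_pos_vecs[OF L c(1)] by blast
  qed
  define fit where "fit \<Lambda> \<longleftrightarrow>
      (\<exists>b \<in> slope_minimizers X \<Lambda> (X *\<^sub>v \<beta>). patt b = patt \<beta>)" for \<Lambda>
  define certified where "certified \<Lambda> \<longleftrightarrow>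
      dual_certificate X \<Lambda> M \<in> slope_subdifferential \<Lambda> (map_vec real_of_int M)" for \<Lambda>
  let ?D = "decreasing_pos_vecs p"
  have "\<exists>\<Lambda> \<in> ?D. certified \<Lambda>" if "\<exists>\<Lambda> \<in> ?D. fit \<Lambda>"
    using that certificate_of_minimizer unfolding fit_def certified_def by blast
  moreover have "\<forall>r > 0. \<exists>\<Lambda> \<in> ?D. \<Lambda> $ 0 < r \<and> fit \<Lambda>" "\<forall>r > 0. \<exists>\<Lambda> \<in> ?D. \<Lambda> $ 0 < r \<and> certified \<Lambda>"
    if "\<exists>\<Lambda> \<in> ?D. certified \<Lambda>"
    using that small unfolding fit_def certified_def by blast+
  moreover have "\<exists>\<Lambda> \<in> ?D. fit \<Lambda>" if "\<forall>r > 0. \<exists>\<Lambda> \<in> ?D. \<Lambda> $ 0 < r \<and> fit \<Lambda>"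
    using that[rule_format, of 1] by auto
  moreover have "\<exists>\<Lambda> \<in> ?D. certified \<Lambda>" if "\<forall>r > 0. \<exists>\<Lambda> \<in> ?D. \<Lambda> $ 0 < r \<and> certified \<Lambda>"
    using that[rule_format, of 1] by auto
  moreover have "\<forall>\<Lambda> \<in> ?D. certified \<Lambda> \<longleftrightarrow> slope_dual_norm \<Lambda> (dual_certificate X \<Lambda> M) \<le> 1 \<and>
      clustered_penalty \<Lambda> M \<in> col_space (clustered_mat X M)\<^sup>T"
    using cert_iff col_iff unfolding certified_def A_def l_def by blast
  ultimately show ?thesis
    unfolding fit_def[symmetric] certified_def[symmetric] by blast
qed

end
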